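(* Let $\lambda_1>0$ and let $\lambda_2\in\mathbb{R}$ with $\lambda_1>\lambda_2$. For $\tau_1,\tau_2>0$ put $T=\tau_1+\tau_2$, let $p$ be the $T$-periodic function with $p(t)=\lambda_1$ for $t\in[0,\tau_1)$ and $p(t)=\lambda_2$ for $t\in[\tau_1,\tau_1+\tau_2)$, and let $\Phi$ be the Poincaré map (time-$T$ map starting from time $0$) of the planar system $$\dot x = xy,\qquad \dot y = x-y^2+p(t).$$ Then there is a nonempty open set of values of $(\tau_1,\tau_2)$ such that, for every $(\tau_1,\tau_2)$ in this set, $\Phi$ induces chaotic dynamics on $m$ symbols for some integer $m\ge 2$.
   Context: Poincaré map: $\Phi(x_0,y_0)=(x(T),y(T))$, where $(x(t),y(t))$ is the solution of the system with $(x(0),y(0))=(x_0,y_0)$; the domain of $\Phi$ is the set of $(x_0,y_0)\in\mathbb{R}^2$ whose solution exists on $[0,T]$. Equivalently $\Phi=\Phi_{\lambda_2}\circ\Phi_{\lambda_1}$, where $\Phi_{\lambda_i}$ is the time-$\tau_i$ map of the autonomous system $\dot x=xy$, $\dot y=x-y^2+\lambda_i$. Chaotic dynamics: let $\Sigma_m=\{0,\dots,m-1\}^{\mathbb{Z}}$. Let $h:\mathrm{dom}\,h\subseteq\mathbb{R}^2\to\mathbb{R}^2$ be a map and let $\mathcal{D}\subseteq\mathrm{dom}\,h$ be a nonempty set. We say that $h$ induces chaotic dynamics on $m\ge2$ symbols on $\mathcal{D}$ if there exist $m$ nonempty pairwise disjoint compact sets $\mathcal{K}_0,\dots,\mathcal{K}_{m-1}\subseteq\mathcal{D}$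 such that for each two-sided sequence $(s_i)_{i\in\mathbb{Z}}\in\Sigma_m$ there exists a sequence $(w_i)_{i\in\mathbb{Z}}\in\mathcal{D}^{\mathbb{Z}}$ with $$w_i\in\mathcal{K}_{s_i}\ \text{ and }\ w_{i+1}=h(w_i)\quad\text{for all } i\in\mathbb{Z},$$ and, whenever $(s_i)_{i\in\mathbb{Z}}$ is $k$-periodic for some $k\ge1$, there exists a $k$-periodic sequence $(w_i)_{i\in\mathbb{Z}}\in\mathcal{D}^{\mathbb{Z}}$ with this property. "Induces chaotic dynamics on $m$ symbols" means that it does so on some nonempty set $\mathcal{D}\subseteq\mathrm{dom}\,h$. *)

theory Defs
  imports "HOL-Analysis.Analysis"
begin

(* The phase of t in its period is t - T * floor (t / T), a number in [0, T). *)
definition switched_forcing :: "real \<Rightarrow> real \<Rightarrow> real \<Rightarrow> real \<Rightarrow> real \<Rightarrow> real" where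
  "switched_forcing lam\<^sub>1 lam\<^sub>2 \<tau>\<^sub>1 \<tau>\<^sub>2 t =
     (if t - (\<tau>\<^sub>1 + \<tau>\<^sub>2) * of_int \<lfloor>t / (\<tau>\<^sub>1 + \<tau>\<^sub>2)\<rfloor> < \<tau>\<^sub>1 then lam\<^sub>1 else lam\<^sub>2)"

definition planar_field :: "real \<Rightarrow> real \<times> real \<Rightarrow> real \<times> real" where
  "planar_field q = (\<lambda>(x, y). (x * y, x - y\<^sup>2 + q))"

(* p jumps, so solutions are meant in the sense of Caratheodory: continuous functions
   satisfying the integral form of the initial value problem on [0, T]. *)
definition solves_ivp ::
  "(real \<Rightarrow> real) \<Rightarrow> real \<Rightarrow> real \<times> real \<Rightarrow> (real \<Rightarrow> real \<times> real) \<Rightarrow> bool" where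
  "solves_ivp p T z\<^sub>0 z \<longleftrightarrow>
     z 0 = z\<^sub>0 \<and> continuous_on {0..T} z \<and>
     (\<forall>t\<in>{0..T}. ((\<lambda>s. planar_field (p s) (z s)) has_integral (z t - z\<^sub>0)) {0..t})"

(* A partial map: its domain consists of the initial points whose solution exists on [0, T].
   THE is justified by uniqueness of solutions (the field is locally Lipschitz in the state). *)
definition poincare_map :: "(real \<Rightarrow> real) \<Rightarrow> real \<Rightarrow> real \<times> real \<rightharpoonup> real \<times> real" where
  "poincare_map p T z\<^sub>0 =
     (if \<exists>z. solves_ivp p T z\<^sub>0 z then Some (THE w. \<exists>z. solves_ivp p T z\<^sub>0 z \<and> z T = w) else None)"

definition periodic_seq :: "nat \<Rightarrow> (int \<Rightarrow> 'a) \<Rightarrow> bool" where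
  "periodic_seq k s \<longleftrightarrow> (\<forall>i. s (i + int k) = s i)"

definition follows_itinerary ::
  "('a \<rightharpoonup> 'a) \<Rightarrow> (nat \<Rightarrow> 'a set) \<Rightarrow> (int \<Rightarrow> nat) \<Rightarrow> (int \<Rightarrow> 'a) \<Rightarrow> bool" where
  "follows_itinerary h K s w \<longleftrightarrow> (\<forall>i. w i \<in> K (s i) \<and> h (w i) = Some (w (i + 1)))"

definition induces_chaotic_dynamics_on ::
  "('a::topological_space \<rightharpoonup> 'a) \<Rightarrow> nat \<Rightarrow> 'a set \<Rightarrow> bool" where
  "induces_chaotic_dynamics_on h m D \<longleftrightarrow>
     m \<ge> 2 \<and> D \<noteq> {} \<and> D \<subseteq> dom h \<and>
     (\<exists>K. (\<forall>i<m. K i \<noteq> {} \<and> compact (K i) \<and> K i \<subseteq> D) \<and> disjoint_family_on K {..<m} \<and>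
       (\<forall>s. range s \<subseteq> {..<m} \<longrightarrow>
         (\<exists>w. range w \<subseteq> D \<and> follows_itinerary h K s w) \<and>
         (\<forall>k\<ge>1. periodic_seq k s \<longrightarrow>
           (\<exists>w. range w \<subseteq> D \<and> periodic_seq k w \<and> follows_itinerary h K s w))))"

definition induces_chaotic_dynamics :: "('a::topological_space \<rightharpoonup> 'a) \<Rightarrow> nat \<Rightarrow> bool" where
  "induces_chaotic_dynamics h m \<longleftrightarrow> (\<exists>D. induces_chaotic_dynamics_on h m D)"

end

theory Submission
  imports Defs
begin

text \<open>
Write \<open>\<lambda>\<close> and \<open>\<mu>\<close> for the larger and the smaller value of the forcing. While the forcing equals \<open>q\<close>, the
substitution \<open>v = x y\<close> turns the system into Newton's equation \<open>x' = v\<close>, \<open>v' = x (x + q)\<close>, which conserves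
the energy \<open>v\<^sup>2 - 2/3 x\<^sup>3 - q x\<^sup>2\<close> and is reversed in time by \<open>(x, v) \<mapsto> (x, - v)\<close>. The argument lives in
\<open>x < 0\<close>, where \<open>y = v / x\<close> brings the motion back to the original plane.

First phase. The orbit through the inner turning point \<open>(- e, 0)\<close>, \<open>0 < e < \<lambda> / 2\<close>, is periodic. The
factorised energy relation and \<open>x = - e - B sin\<^sup>2 \<theta>\<close> give \<open>\<theta>' = sqrt ((D - B cos\<^sup>2 \<theta>) / 6)\<close> with explicit
\<open>D\<close> and \<open>B\<close>; hence the period \<open>T e\<close>, the integral of \<open>1 / \<theta>'\<close> over \<open>[0, \<pi>]\<close>, strictly decreases in
\<open>e\<close> (\<open>period_strict_antimono\<close>). The first phase is therefore a twist map, as strong as one likes once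
\<open>\<tau>\<^sub>1\<close> is long.

Second phase, called the kick below. Along it the energy of the first phase changes at the rate
\<open>- 2 (\<lambda> - \<mu>) x v\<close>. Near an inner
turning point \<open>x v\<close> strictly increases along the orbits of the first phase. So for a short \<open>\<tau>\<^sub>2\<close>, and for
two levels \<open>e\<close>, \<open>e'\<close> close to each other, exactly one point near the turning point lies on level \<open>e\<close> and is
sent to level \<open>e'\<close>; with time counted from the turning point, it is found at a small time \<open>r e e'\<close> of either sign, and \<open>r e e'\<close> increases
with \<open>e'\<close> (\<open>transversality\<close>, \<open>kick_window_exists\<close>). By reversibility the image of this point sits on
level \<open>e'\<close> at time \<open>- r e' e\<close>.

Coding. An orbit that occupies the levels \<open>M i\<close> and makes \<open>n i\<close> full turns in its \<open>i\<close>-th first phase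
corresponds therefore to a solution of
\<open>n i * T (M i) = \<tau>\<^sub>1 - r (M i) (M (i + 1)) - r (M i) (M (i - 1))\<close>.
All monotonicities point in the same direction, so the pointwise infimum of the supersolutions solves the
system (\<open>monotone_chain_solution\<close>). Since the infimum is canonical, it inherits every period of \<open>n\<close>. If \<open>\<tau>\<^sub>1\<close> lies in a suitable
open interval, two consecutive turn numbers are admissible in every step; they are the two symbols.
\<close>

section \<open>Global flows of Lipschitz fields\<close>

text \<open>The two-sided Gronwall argument: the square of the norm, weighted by \<open>exp (\<mp> 2 L t)\<close>, is monotone on
either side of \<open>0\<close>. Every uniqueness statement about flows below is an instance.\<close>

lemma zero_if_derivative_dominated:
  fixes d :: "real \<Rightarrow> 'a::real_inner"
  assumes d: "\<And>t. (d has_vector_derivative d' t) (at t)"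
    and bound: "\<And>t. norm (d' t) \<le> L * norm (d t)"
    and init: "d 0 = 0"
  shows "d t = 0"
proof -
  define n where "n t = d t \<bullet> d t" for t
  have n_deriv: "(n has_real_derivative 2 * (d t \<bullet> d' t)) (at t)" for t
    unfolding n_def has_field_derivative_def
    using has_derivative_inner[OF d[unfolded has_vector_derivative_def] d[unfolded has_vector_derivative_def], of t]
    by (rule has_derivative_eq_rhs) (auto simp: inner_commute)
  have dom: "\<bar>d t \<bullet> d' t\<bar> \<le> L * n t" for t
  proof -
    have "\<bar>d t \<bullet> d' t\<bar> \<le> norm (d t) * norm (d' t)"
      by (rule Cauchy_Schwarz_ineq2)
    also have "\<dots> \<le> norm (d t) * (L * norm (d t))"
      by (intro mult_left_mono bound) auto
    also have "\<dots> = L * n t"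
      by (simp add: n_def dot_square_norm power2_eq_square)
    finally show ?thesis .
  qed
  have "n t \<le> 0"
  proof (cases "0 \<le> t")
    case True
    have "n t * exp (- 2 * L * t) \<le> n 0 * exp (- 2 * L * 0)"
    proof (rule DERIV_nonpos_imp_nonincreasing[OF True], intro exI conjI)
      fix x
      show "((\<lambda>t. n t * exp (- 2 * L * t)) has_real_derivative
          (2 * (d x \<bullet> d' x) - 2 * L * n x) * exp (- 2 * L * x)) (at x)"
        by (auto intro!: derivative_eq_intros n_deriv simp: algebra_simps)
      show "(2 * (d x \<bullet> d' x) - 2 * L * n x) * exp (- 2 * L * x) \<le> 0"
        using dom[of x] by (intro mult_nonpos_nonneg) auto
    qed
    then show ?thesis using init by (simp add: n_def mult_le_0_iff)
  next
    case False
    have "n t * exp (2 * L * t) \<le> n 0 * exp (2 * L * 0)"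
    proof (rule DERIV_nonneg_imp_nondecreasing, use False in simp, intro exI conjI)
      fix x
      show "((\<lambda>t. n t * exp (2 * L * t)) has_real_derivative
          (2 * (d x \<bullet> d' x) + 2 * L * n x) * exp (2 * L * x)) (at x)"
        by (auto intro!: derivative_eq_intros n_deriv simp: algebra_simps)
      show "0 \<le> (2 * (d x \<bullet> d' x) + 2 * L * n x) * exp (2 * L * x)"
        using dom[of x] by (intro mult_nonneg_nonneg) auto
    qed
    then show ?thesis using init by (simp add: n_def mult_le_0_iff)
  qed
  then show ?thesis
    using inner_gt_zero_iff[of "d t"] by (simp add: n_def not_less[symmetric] del: inner_gt_zero_iff)
qed

text \<open>Primitives on the whole line, so that the Picard operator can be written for both time directions at
once.\<close>

lemma exists_antiderivative:
  fixes g :: "real \<Rightarrow> 'a::banach"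
  assumes "continuous_on UNIV g"
  shows "\<exists>A. A 0 = 0 \<and> (\<forall>t. (A has_vector_derivative g t) (at t))"
proof -
  define A where "A t = (if 0 \<le> t then integral {0..t} g else - integral {t..0} g)" for t
  have int: "g integrable_on {a..b}" for a b
    using assms continuous_on_subset by (intro integrable_continuous_real) blast
  have "(A has_vector_derivative g t) (at t)" for t
  proof -
    define N where "N = \<bar>t\<bar> + 1"
    have A_eq: "A u = integral {-N..u} g - integral {-N..0} g" if "u \<in> {-N<..<N}" for u
    proof (cases "0 \<le> u")
      case True
      then show ?thesis
        using Henstock_Kurzweil_Integration.integral_combine[where a = "-N" and c = 0 and b = u and f = g] int that by (simp add: A_def N_def eq_diff_eq diff_eq_eq add.commute)
    next
      case False
      then show ?thesis
        using Henstock_Kurzweil_Integration.integral_combine[where a = "-N" and c = u and b = 0 and f = g] int that by (simp add: A_def N_def eq_diff_eq diff_eq_eq add.commute)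
    qed
    have t: "t \<in> {-N<..<N}" by (auto simp: N_def)
    have "((\<lambda>u. integral {-N..u} g) has_vector_derivative g t) (at t within {-N..N})"
      using assms continuous_on_subset t by (intro integral_has_vector_derivative) auto
    then have "((\<lambda>u. integral {-N..u} g - integral {-N..0} g) has_vector_derivative g t) (at t)"
      using t by (auto intro!: derivative_eq_intros simp: at_within_Icc_at)
    then show ?thesis
      by (rule has_vector_derivative_transform_within_open[where S = "{-N<..<N}"]) (use t A_eq in auto)
  qed
  moreover have "A 0 = 0" by (simp add: A_def)
  ultimately show ?thesis by blast
qed

lemma antiderivative_exp_bound:
  fixes A :: "real \<Rightarrow> 'a::real_normed_vector"
  assumes A: "\<And>t. (A has_vector_derivative g t) (at t)" and A0: "A 0 = 0"
    and g: "\<And>t. norm (g t) \<le> C * exp (c * \<bar>t\<bar>)" and c: "c > 0"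
  shows "norm (A t) \<le> C / c * exp (c * \<bar>t\<bar>)"
proof -
  have C: "0 \<le> C" using order_trans[OF norm_ge_zero g[of 0]] by simp
  have forward: "norm (B t) \<le> C / c * exp (c * t)"
    if B: "\<And>t. (B has_vector_derivative h t) (at t)" "B 0 = 0"
      "\<And>t. norm (h t) \<le> C * exp (c * \<bar>t\<bar>)" and t: "0 < t" for B h and t :: real
  proof -
    have "norm (B t - B 0) \<le> C / c * exp (c * t) - C / c * exp (c * 0)"
    proof (rule differentiable_bound_general[OF t])
      show "continuous_on {0..t} B"
        using B(1) continuous_on_vector_derivative has_vector_derivative_at_within by blast
      show "continuous_on {0..t} (\<lambda>t. C / c * exp (c * t))"
        by (intro continuous_intros)
      show "(B has_vector_derivative h x) (at x)" for x by (rule B)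
      show "((\<lambda>t. C / c * exp (c * t)) has_vector_derivative C * exp (c * x)) (at x)" for x
        using c unfolding has_real_derivative_iff_has_vector_derivative[symmetric]
        by (auto intro!: derivative_eq_intros)
      show "norm (h x) \<le> C * exp (c * x)" if "0 < x" for x using B(3)[of x] that by simp
    qed
    then show ?thesis using B(2) C c by (simp add: field_simps)
  qed
  consider "0 < t" | "t = 0" | "t < 0" by linarith
  then show ?thesis
  proof cases
    case 1
    then show ?thesis using forward[OF A A0 g] by simp
  next
    case 2
    then show ?thesis using A0 C c by simp
  next
    case 3
    have "norm ((\<lambda>s. A (- s)) (- t)) \<le> C / c * exp (c * (- t))"
    proof (rule forward)
      show "((\<lambda>s. A (- s)) has_vector_derivative - g (- s)) (at s)" for s
      proof -
        have "(uminus has_vector_derivative (- 1)) (at s)"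
          by (auto intro!: derivative_eq_intros)
        from vector_diff_chain_at[OF this A] show ?thesis by (simp add: o_def)
      qed
    qed (use A0 g 3 in \<open>auto simp: norm_minus_cancel\<close>, metis abs_minus_cancel g)
    then show ?thesis using 3 by simp
  qed
qed

text \<open>Picard's theorem determines the flow uniquely; the choice operator serves only to give it a name.\<close>

definition lipschitz_flow :: "('a::banach \<Rightarrow> 'a) \<Rightarrow> real \<Rightarrow> real \<Rightarrow> 'a \<Rightarrow> 'a" where
  "lipschitz_flow F L = (SOME \<phi>. \<forall>z. \<phi> 0 z = z \<and>
     (\<forall>t. ((\<lambda>t. \<phi> t z) has_vector_derivative F (\<phi> t z)) (at t)) \<and>
     (\<forall>t w. norm (\<phi> t z - \<phi> t w) \<le> 2 * exp (2 * L * \<bar>t\<bar>) * norm (z - w)))"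

text \<open>Picard iteration in the space of functions of growth \<open>exp (2 L \<bar>t\<bar>)\<close>: after division by this weight they
become bounded continuous functions on the line, and the integral operator contracts with factor
\<open>1/2\<close> for all times at once, so that no continuation of local solutions is required. Comparing the fixed
points for two initial values gives the dependence estimate.\<close>

lemma lipschitz_flow_exists:
  fixes F :: "'a::banach \<Rightarrow> 'a"
  assumes lip: "\<And>z w. norm (F z - F w) \<le> L * norm (z - w)" and L: "L > 0"
  shows "\<exists>\<phi>. \<forall>z. \<phi> 0 z = z \<and>
     (\<forall>t. ((\<lambda>t. \<phi> t z) has_vector_derivative F (\<phi> t z)) (at t)) \<and>
     (\<forall>t w. norm (\<phi> t z - \<phi> t w) \<le> 2 * exp (2 * L * \<bar>t\<bar>) * norm (z - w))"
proof -
  define c where "c = 2 * L"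
  have c: "c > 0" using L by (simp add: c_def)
  have F_cont: "continuous_on UNIV F"
    using L lip by (intro lipschitz_on_continuous_on[of L] lipschitz_onI) (auto simp: dist_norm)
  have cancel: "exp (- c * \<bar>t\<bar>) * (K * exp (c * \<bar>t\<bar>)) = K" for K t
    by (simp add: exp_minus)
  define prim where "prim g = (SOME A. A 0 = 0 \<and> (\<forall>t. (A has_vector_derivative g t) (at t)))"
    for g :: "real \<Rightarrow> 'a"
  have prim: "prim g 0 = 0" "(prim g has_vector_derivative g t) (at t)"
    if "continuous_on UNIV g" for g t
    using someI_ex[OF exists_antiderivative[OF that]] by (auto simp: prim_def)
  define force where "force y s = F (exp (c * \<bar>s\<bar>) *\<^sub>R apply_bcontfun y s)"
    for y :: "real \<Rightarrow>\<^sub>C 'a" and s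
  have force_cont: "continuous_on UNIV (force y)" for y
    unfolding force_def by (intro continuous_on_compose2[OF F_cont]) (auto intro!: continuous_intros)
  define step where "step z y t = exp (- c * \<bar>t\<bar>) *\<^sub>R (z + prim (force y) t)" for z y t
  have prim_cont: "continuous_on UNIV (prim (force y))" for y
    using prim(2)[OF force_cont] continuous_on_vector_derivative has_vector_derivative_at_within by blast
  have norm_y: "norm (apply_bcontfun y s) \<le> norm y" for y :: "real \<Rightarrow>\<^sub>C 'a" and s
    using dist_bounded[of y s 0] by (simp add: dist_norm)
  have step_mem: "step z y \<in> bcontfun" for z y
  proof -
    have "continuous_on UNIV (step z y)"
      unfolding step_def by (intro continuous_intros prim_cont)
    moreover have "norm (step z y t) \<le> norm z + (norm (F 0) + L * norm y) / c" for t
    proof -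
      have "norm (force y s) \<le> (norm (F 0) + L * norm y) * exp (c * \<bar>s\<bar>)" for s
      proof -
        have "norm (force y s) \<le> norm (F 0) + L * (exp (c * \<bar>s\<bar>) * norm (apply_bcontfun y s))"
          using lip[of "exp (c * \<bar>s\<bar>) *\<^sub>R apply_bcontfun y s" 0]
            norm_triangle_sub[of "force y s" "F 0"] by (simp add: force_def)
        also have "\<dots> \<le> norm (F 0) * exp (c * \<bar>s\<bar>) + L * (exp (c * \<bar>s\<bar>) * norm y)"
          using c L norm_y by (intro add_mono mult_left_mono) (auto simp: mult_le_cancel_left1)
        finally show ?thesis by (simp add: algebra_simps)
      qed
      from antiderivative_exp_bound[OF prim(2)[OF force_cont] prim(1)[OF force_cont] this c]
      have "norm (prim (force y) t) \<le> (norm (F 0) + L * norm y) / c * exp (c * \<bar>t\<bar>)" .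
      moreover have "norm z \<le> norm z * exp (c * \<bar>t\<bar>)"
        using c by (simp add: mult_le_cancel_left1)
      ultimately have "norm (z + prim (force y) t)
          \<le> (norm z + (norm (F 0) + L * norm y) / c) * exp (c * \<bar>t\<bar>)"
        using norm_triangle_ineq[of z "prim (force y) t"] by (simp add: distrib_right)
      then have "norm (step z y t) \<le> exp (- c * \<bar>t\<bar>) *
          ((norm z + (norm (F 0) + L * norm y) / c) * exp (c * \<bar>t\<bar>))"
        by (simp add: step_def)
      then show ?thesis
        by (simp only: cancel)
    qed
    ultimately show ?thesis
      unfolding bcontfun_def bounded_iff by blast
  qed
  define \<Gamma> where "\<Gamma> z y = Bcontfun (step z y)" for z y
  have \<Gamma>: "apply_bcontfun (\<Gamma> z y) = step z y" for z y
    using step_mem by (simp add: \<Gamma>_def Bcontfun_inverse)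
  have \<Gamma>_dist: "dist (\<Gamma> z y) (\<Gamma> w y') \<le> norm (z - w) + 1 / 2 * dist y y'" for z w y y'
  proof (rule dist_bound)
    fix t
    have diff: "((\<lambda>t. prim (force y) t - prim (force y') t) has_vector_derivative
        force y t - force y' t) (at t)" for t
      by (intro has_vector_derivative_diff prim force_cont)
    have "norm (force y s - force y' s) \<le> (L * dist y y') * exp (c * \<bar>s\<bar>)" for s
    proof -
      have "norm (force y s - force y' s)
          \<le> L * norm (exp (c * \<bar>s\<bar>) *\<^sub>R (apply_bcontfun y s - apply_bcontfun y' s))"
        using lip by (simp add: force_def scaleR_diff_right)
      also have "\<dots> = L * (exp (c * \<bar>s\<bar>) * dist (apply_bcontfun y s) (apply_bcontfun y' s))"
        by (simp add: dist_norm)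
      also have "\<dots> \<le> L * (exp (c * \<bar>s\<bar>) * dist y y')"
        using L by (intro mult_left_mono dist_bounded) auto
      finally show ?thesis by (simp add: algebra_simps)
    qed
    from antiderivative_exp_bound[OF diff _ this c] prim(1)[OF force_cont]
    have "norm (prim (force y) t - prim (force y') t) \<le> L * dist y y' / c * exp (c * \<bar>t\<bar>)"
      by simp
    also have "L * dist y y' / c = 1 / 2 * dist y y'" using L by (simp add: c_def)
    finally have 1: "norm (prim (force y) t - prim (force y') t) \<le> 1 / 2 * dist y y' * exp (c * \<bar>t\<bar>)" .
    have 2: "norm (z - w) \<le> norm (z - w) * exp (c * \<bar>t\<bar>)"
      using c by (simp add: mult_le_cancel_left1)
    have "norm ((z + prim (force y) t) - (w + prim (force y') t))
        \<le> norm (z - w) + norm (prim (force y) t - prim (force y') t)"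
      by (metis add_diff_add norm_triangle_ineq)
    with 1 2 have "norm ((z + prim (force y) t) - (w + prim (force y') t))
        \<le> (norm (z - w) + 1 / 2 * dist y y') * exp (c * \<bar>t\<bar>)"
      by (simp add: distrib_right)
    then have "exp (- c * \<bar>t\<bar>) * norm ((z + prim (force y) t) - (w + prim (force y') t))
        \<le> exp (- c * \<bar>t\<bar>) * ((norm (z - w) + 1 / 2 * dist y y') * exp (c * \<bar>t\<bar>))"
      by (intro mult_left_mono) auto
    then show "dist (apply_bcontfun (\<Gamma> z y) t) (apply_bcontfun (\<Gamma> w y') t) \<le> norm (z - w) + 1 / 2 * dist y y'"
      unfolding cancel by (simp add: \<Gamma> step_def dist_norm scaleR_diff_right[symmetric])
  qed
  have "\<exists>!y. \<Gamma> z y = y" for z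
    using banach_fix_type[of "1/2" "\<Gamma> z"] \<Gamma>_dist[of z _ z] by simp
  then obtain Y where Y: "\<Gamma> z (Y z) = Y z" for z by metis
  define \<phi> where "\<phi> t z = exp (c * \<bar>t\<bar>) *\<^sub>R apply_bcontfun (Y z) t" for t z
  have \<phi>_eq: "\<phi> t z = z + prim (force (Y z)) t" for t z
    using arg_cong[OF Y[of z], of "\<lambda>y. apply_bcontfun y t", symmetric]
    by (simp add: \<phi>_def \<Gamma> step_def exp_minus)
  have "\<phi> 0 z = z" for z by (simp add: \<phi>_eq prim(1)[OF force_cont])
  moreover have "((\<lambda>t. \<phi> t z) has_vector_derivative F (\<phi> t z)) (at t)" for t z
  proof -
    have "((\<lambda>t. z + prim (force (Y z)) t) has_vector_derivative force (Y z) t) (at t)"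
      using prim(2)[OF force_cont] by (auto intro!: derivative_eq_intros)
    then show ?thesis by (simp add: \<phi>_eq[symmetric] force_def \<phi>_def)
  qed
  moreover have "norm (\<phi> t z - \<phi> t w) \<le> 2 * exp (2 * L * \<bar>t\<bar>) * norm (z - w)" for t z w
  proof -
    have "dist (Y z) (Y w) \<le> norm (z - w) + 1 / 2 * dist (Y z) (Y w)"
      using \<Gamma>_dist[of z "Y z" w "Y w"] by (simp add: Y)
    then have "dist (apply_bcontfun (Y z) t) (apply_bcontfun (Y w) t) \<le> 2 * norm (z - w)"
      using dist_bounded[of "Y z" t "Y w"] by simp
    then have "exp (c * \<bar>t\<bar>) * norm (apply_bcontfun (Y z) t - apply_bcontfun (Y w) t)
        \<le> exp (c * \<bar>t\<bar>) * (2 * norm (z - w))"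
      by (intro mult_left_mono) (auto simp: dist_norm)
    then show ?thesis
      by (simp add: \<phi>_def c_def scaleR_diff_right[symmetric] mult.commute mult.left_commute)
  qed
  ultimately show ?thesis by blast
qed

lemma
  fixes F :: "'a::banach \<Rightarrow> 'a"
  assumes lip: "\<And>z w. norm (F z - F w) \<le> L * norm (z - w)" and L: "L > 0"
  shows lipschitz_flow_0: "lipschitz_flow F L 0 z = z"
    and lipschitz_flow_deriv:
      "((\<lambda>t. lipschitz_flow F L t z) has_vector_derivative F (lipschitz_flow F L t z)) (at t)"
    and lipschitz_flow_dependence:
      "norm (lipschitz_flow F L t z - lipschitz_flow F L t w) \<le> 2 * exp (2 * L * \<bar>t\<bar>) * norm (z - w)"
  using someI_ex[OF lipschitz_flow_exists[OF lip L]] unfolding lipschitz_flow_def by blast+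

section \<open>The Newton equation for \<open>x\<close>\<close>

text \<open>Cutting \<open>x\<close> to \<open>[- R, 0]\<close> in the force makes the field globally Lipschitz and changes nothing on the
motions with \<open>x\<close> in this range, which are the only ones of interest.\<close>

definition cut :: "real \<Rightarrow> real \<Rightarrow> real" where
  "cut R x = max (- R) (min 0 x)"

definition newton_field :: "real \<Rightarrow> real \<Rightarrow> real \<times> real \<Rightarrow> real \<times> real" where
  "newton_field R q z = (snd z, cut R (fst z) * (cut R (fst z) + q))"

definition newton_lip :: "real \<Rightarrow> real \<Rightarrow> real" where
  "newton_lip R q = 1 + 2 * R + \<bar>q\<bar>"

definition newton_flow :: "real \<Rightarrow> real \<Rightarrow> real \<Rightarrow> real \<times> real \<Rightarrow> real \<times> real" where
  "newton_flow R q = lipschitz_flow (newton_field R q) (newton_lip R q)"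

definition reflect :: "real \<times> real \<Rightarrow> real \<times> real" where
  "reflect z = (fst z, - snd z)"

definition energy :: "real \<Rightarrow> real \<times> real \<Rightarrow> real" where
  "energy q z = (snd z)\<^sup>2 - 2 / 3 * fst z ^ 3 - q * (fst z)\<^sup>2"

lemma cut_eq [simp]: "x \<in> {-R..0} \<Longrightarrow> cut R x = x"
  by (auto simp: cut_def)

lemma newton_field_lipschitz:
  assumes "R > 0"
  shows "norm (newton_field R q z - newton_field R q w) \<le> newton_lip R q * norm (z - w)"
proof -
  let ?c = "cut R (fst z)" and ?d = "cut R (fst w)"
  have cd: "\<bar>?c\<bar> \<le> R" "\<bar>?d\<bar> \<le> R" "\<bar>?c - ?d\<bar> \<le> \<bar>fst z - fst w\<bar>"
    using assms by (auto simp: cut_def)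
  have fst: "\<bar>fst z - fst w\<bar> \<le> norm (z - w)" and snd: "\<bar>snd z - snd w\<bar> \<le> norm (z - w)"
    by (metis fst_diff norm_fst_le prod.collapse real_norm_def)
       (metis snd_diff norm_snd_le prod.collapse real_norm_def)
  have "\<bar>?c * (?c + q) - ?d * (?d + q)\<bar> = \<bar>?c - ?d\<bar> * \<bar>?c + ?d + q\<bar>"
    by (simp add: abs_mult[symmetric] algebra_simps)
  also have "\<dots> \<le> norm (z - w) * (2 * R + \<bar>q\<bar>)"
    using cd fst assms by (intro mult_mono) auto
  finally have 2: "\<bar>?c * (?c + q) - ?d * (?d + q)\<bar> \<le> (2 * R + \<bar>q\<bar>) * norm (z - w)"
    by (simp add: mult.commute)
  have "norm (newton_field R q z - newton_field R q w)
      \<le> \<bar>snd z - snd w\<bar> + \<bar>?c * (?c + q) - ?d * (?d + q)\<bar>"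
    using norm_Pair_le[of "snd z - snd w" "?c * (?c + q) - ?d * (?d + q)"]
    by (simp add: newton_field_def)
  then show ?thesis using snd 2 by (simp add: newton_lip_def distrib_right)
qed

lemma newton_lip_pos: "R > 0 \<Longrightarrow> newton_lip R q > 0"
  by (simp add: newton_lip_def)

context
  fixes R q :: real
  assumes R: "R > 0"
begin

lemmas flow_facts = newton_field_lipschitz[OF R, of q] newton_lip_pos[OF R, of q]

lemma newton_flow_0 [simp]: "newton_flow R q 0 z = z"
  unfolding newton_flow_def by (rule lipschitz_flow_0[OF flow_facts])

lemma newton_flow_deriv:
  "((\<lambda>t. newton_flow R q t z) has_vector_derivative newton_field R q (newton_flow R q t z)) (at t)"
  unfolding newton_flow_def by (rule lipschitz_flow_deriv[OF flow_facts])

lemma newton_flow_dependence: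
  "norm (newton_flow R q t z - newton_flow R q t w) \<le> 2 * exp (2 * newton_lip R q * \<bar>t\<bar>) * norm (z - w)"
  unfolding newton_flow_def by (rule lipschitz_flow_dependence[OF flow_facts])

lemma newton_flow_unique:
  assumes "\<And>t. (u has_vector_derivative newton_field R q (u t)) (at t)"
  shows "u t = newton_flow R q t (u 0)"
proof -
  have "u t - newton_flow R q t (u 0) = 0"
  proof (rule zero_if_derivative_dominated[where d = "\<lambda>t. u t - newton_flow R q t (u 0)" and L = "newton_lip R q"])
    show "((\<lambda>t. u t - newton_flow R q t (u 0)) has_vector_derivative
      newton_field R q (u t) - newton_field R q (newton_flow R q t (u 0))) (at t)" for t
      by (intro has_vector_derivative_diff assms newton_flow_deriv)
  qed (auto intro: newton_field_lipschitz[OF R])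
  then show ?thesis by simp
qed

lemma newton_flow_add: "newton_flow R q (s + t) z = newton_flow R q t (newton_flow R q s z)"
proof -
  have "((\<lambda>t. newton_flow R q (s + t) z) has_vector_derivative
      newton_field R q (newton_flow R q (s + t) z)) (at t)" for t
  proof -
    have "((+) s has_vector_derivative 1) (at t)"
      by (auto intro!: derivative_eq_intros)
    from vector_diff_chain_at[OF this newton_flow_deriv] show ?thesis by (simp add: o_def)
  qed
  from newton_flow_unique[OF this] show ?thesis by simp
qed

lemma newton_flow_reflect: "reflect (newton_flow R q t z) = newton_flow R q (- t) (reflect z)"
proof -
  have "((\<lambda>t. reflect (newton_flow R q (- t) z)) has_vector_derivative
      newton_field R q (reflect (newton_flow R q (- t) z))) (at t)" for t
  proof -
    have "(uminus has_vector_derivative (- 1)) (at t)"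
      by (auto intro!: derivative_eq_intros)
    from vector_diff_chain_at[OF this newton_flow_deriv]
    have *: "((\<lambda>t. newton_flow R q (- t) z) has_vector_derivative
        - newton_field R q (newton_flow R q (- t) z)) (at t)"
      by (simp add: o_def)
    have "bounded_linear reflect"
      unfolding reflect_def
      by (intro bounded_linear_Pair bounded_linear_minus bounded_linear_fst bounded_linear_snd)
    from bounded_linear.has_vector_derivative[OF this *]
    show ?thesis by (simp add: reflect_def newton_field_def)
  qed
  from newton_flow_unique[OF this, of "- t"] show ?thesis by simp
qed

text \<open>Reversibility in the form used later: a flow conjugated by the reflection is its own inverse.\<close>

lemma newton_flow_reflect_inverse:
  "newton_flow R q t (reflect (newton_flow R q t z)) = reflect z"
  using newton_flow_add[of "- t" t "reflect z"] by (simp add: newton_flow_reflect)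

lemma newton_flow_deriv_fst:
  "((\<lambda>t. fst (newton_flow R q t z)) has_real_derivative snd (newton_flow R q t z)) (at t)"
  using bounded_linear.has_vector_derivative[OF bounded_linear_fst newton_flow_deriv]
  by (simp add: newton_field_def has_real_derivative_iff_has_vector_derivative)

lemma newton_flow_deriv_snd:
  assumes "fst (newton_flow R q t z) \<in> {-R..0}"
  shows "((\<lambda>t. snd (newton_flow R q t z)) has_real_derivative
    fst (newton_flow R q t z) * (fst (newton_flow R q t z) + q)) (at t)"
  using bounded_linear.has_vector_derivative[OF bounded_linear_snd newton_flow_deriv[of z t]] assms
  by (simp add: newton_field_def has_real_derivative_iff_has_vector_derivative)

lemma continuous_newton_flow: "continuous_on UNIV (\<lambda>(t, z). newton_flow R q t z)"
proof -
  have "((\<lambda>(t, z). newton_flow R q t z) \<longlongrightarrow> newton_flow R q t\<^sub>0 z\<^sub>0) (at (t\<^sub>0, z\<^sub>0))" for t\<^sub>0 z\<^sub>0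
  proof -
    have eq: "newton_flow R q (fst p) (snd p) - newton_flow R q t\<^sub>0 z\<^sub>0 =
      (newton_flow R q (fst p) (snd p) - newton_flow R q (fst p) z\<^sub>0) +
      (newton_flow R q (fst p) z\<^sub>0 - newton_flow R q t\<^sub>0 z\<^sub>0)" for p by simp
    have "((\<lambda>p. 2 * exp (2 * newton_lip R q * \<bar>fst p\<bar>) * norm (snd p - z\<^sub>0)) \<longlongrightarrow>
        2 * exp (2 * newton_lip R q * \<bar>fst (t\<^sub>0, z\<^sub>0)\<bar>) * norm (snd (t\<^sub>0, z\<^sub>0) - z\<^sub>0)) (at (t\<^sub>0, z\<^sub>0))"
      by (intro tendsto_intros)
    then have "((\<lambda>p. 2 * exp (2 * newton_lip R q * \<bar>fst p\<bar>) * norm (snd p - z\<^sub>0)) \<longlongrightarrow> 0) (at (t\<^sub>0, z\<^sub>0))"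
      by simp
    then have 1: "((\<lambda>p. newton_flow R q (fst p) (snd p) - newton_flow R q (fst p) z\<^sub>0) \<longlongrightarrow> 0) (at (t\<^sub>0, z\<^sub>0))"
      by (rule Lim_null_comparison[rotated]) (auto intro!: always_eventually newton_flow_dependence)
    have "isCont (\<lambda>t. newton_flow R q t z\<^sub>0) t\<^sub>0"
      using newton_flow_deriv by (rule has_vector_derivative_continuous)
    then have "((\<lambda>p. newton_flow R q (fst p) z\<^sub>0) \<longlongrightarrow> newton_flow R q t\<^sub>0 z\<^sub>0) (at (t\<^sub>0, z\<^sub>0))"
      by (rule isCont_tendsto_compose) (auto intro!: tendsto_eq_intros)
    then have 2: "((\<lambda>p. newton_flow R q (fst p) z\<^sub>0 - newton_flow R q t\<^sub>0 z\<^sub>0) \<longlongrightarrow> 0) (at (t\<^sub>0, z\<^sub>0))"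
      by (simp add: LIM_zero)
    show ?thesis
      unfolding case_prod_beta using tendsto_add[OF 1 2] by (simp add: LIM_zero_iff)
  qed
  then show ?thesis by (auto simp: continuous_on_def)
qed

lemma continuous_on_newton_flow:
  assumes "continuous_on S f" "continuous_on S g"
  shows "continuous_on S (\<lambda>x. newton_flow R q (f x) (g x))"
  using continuous_on_compose2[OF continuous_newton_flow continuous_on_Pair[OF assms]] by simp

lemma newton_flow_energy:
  assumes S: "convex S" "0 \<in> S" "t \<in> S"
    and range: "\<And>s. s \<in> S \<Longrightarrow> fst (newton_flow R q s z) \<in> {-R..0}"
  shows "energy q (newton_flow R q t z) = energy q z"
proof -
  have "((\<lambda>t. energy q (newton_flow R q t z)) has_real_derivative 0) (at s within S)" if "s \<in> S" for s
  proof -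
    let ?x = "fst (newton_flow R q s z)" and ?v = "snd (newton_flow R q s z)"
    have "((\<lambda>t. energy q (newton_flow R q t z)) has_real_derivative
        2 * ?v * (?x * (?x + q)) - 2 / 3 * (3 * ?x\<^sup>2 * ?v) - q * (2 * ?x * ?v)) (at s)"
      unfolding energy_def
      by (rule derivative_eq_intros newton_flow_deriv_fst newton_flow_deriv_snd[OF range[OF that]] refl | simp)+
    also have "2 * ?v * (?x * (?x + q)) - 2 / 3 * (3 * ?x\<^sup>2 * ?v) - q * (2 * ?x * ?v) = 0"
      by (simp add: algebra_simps power2_eq_square)
    finally show ?thesis by (rule has_field_derivative_at_within)
  qed
  from has_field_derivative_zero_constant[OF S(1) this]
  obtain c where "\<And>s. s \<in> S \<Longrightarrow> energy q (newton_flow R q s z) = c" by blast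
  from this[OF S(2)] this[OF S(3)] show ?thesis by simp
qed

end

section \<open>The periodic orbits of the first phase\<close>

text \<open>On the level through \<open>(- e, 0)\<close> the energy relation reads \<open>v\<^sup>2 = 2/3 (x - r1) (x - r2) (x - r3)\<close> with
\<open>r1 < r2 = - e < 0 < r3\<close>, and the motion takes place on \<open>[r1, r2]\<close>. The other two roots solve a quadratic
equation; \<open>root_gap\<close> is their distance \<open>r3 - r1\<close>, and \<open>amplitude\<close> is \<open>r2 - r1\<close>.\<close>

definition root_gap :: "real \<Rightarrow> real \<Rightarrow> real" where
  "root_gap lam e = sqrt (9 / 4 * lam\<^sup>2 + 3 * lam * e - 3 * e\<^sup>2)"

definition amplitude :: "real \<Rightarrow> real \<Rightarrow> real" where
  "amplitude lam e = root_gap lam e / 2 + 3 / 4 * lam - 3 / 2 * e"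

text \<open>The speed of \<open>\<theta>\<close> when \<open>x = - e - amplitude * sin\<^sup>2 \<theta>\<close>, that is, when \<open>\<theta>\<close> is the Jacobi amplitude of the
elliptic motion.\<close>

definition angular_speed :: "real \<Rightarrow> real \<Rightarrow> real \<Rightarrow> real" where
  "angular_speed lam e \<theta> = sqrt ((root_gap lam e - amplitude lam e * (cos \<theta>)\<^sup>2) / 6)"

text \<open>The function \<open>x\<close> repeats when \<open>\<theta>\<close> increases by \<open>\<pi>\<close>, hence the upper limit.\<close>

definition period :: "real \<Rightarrow> real \<Rightarrow> real" where
  "period lam e = integral {0..pi} (\<lambda>\<theta>. 1 / angular_speed lam e \<theta>)"

definition orbit :: "real \<Rightarrow> real \<Rightarrow> real \<Rightarrow> real \<times> real" where
  "orbit lam e t = newton_flow (2 * lam) lam t (- e, 0)"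

definition level :: "real \<Rightarrow> real \<Rightarrow> real" where
  "level lam e = energy lam (- e, 0)"

lemma level_strict_antimono:
  assumes "0 < e" "e < e'" "e' < lam / 2"
  shows "level lam e' < level lam e"
proof -
  have "level lam e' - level lam e = (e' - e) * (2 / 3 * (e\<^sup>2 + e * e' + e'\<^sup>2) - lam * (e + e'))"
    by (simp add: level_def energy_def field_simps power2_eq_square power3_eq_cube)
  also have "\<dots> < 0"
  proof (rule mult_pos_neg)
    have "2 / 3 * (e\<^sup>2 + e * e' + e'\<^sup>2) \<le> (e + e') * (e + e')"
    proof -
      have "0 \<le> e * e" "0 \<le> e * e'" "0 \<le> e' * e'" using assms by auto
      moreover have "(e + e') * (e + e') = e * e + 2 * (e * e') + e' * e'" by (simp add: algebra_simps)
      moreover have "2 / 3 * (u + v + w) \<le> u + 2 * v + w" if "0 \<le> u" "0 \<le> v" "0 \<le> w" for u v w :: real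
        using that by argo
      ultimately show ?thesis unfolding power2_eq_square by simp
    qed
    also have "\<dots> < lam * (e + e')"
      using assms by (intro mult_strict_right_mono) auto
    finally show "2 / 3 * (e\<^sup>2 + e * e' + e'\<^sup>2) - lam * (e + e') < 0" by simp
  qed (use assms in auto)
  finally show ?thesis by simp
qed

lemma level_inj:
  assumes "level lam e = level lam e'" "0 < e" "e < lam / 2" "0 < e'" "e' < lam / 2"
  shows "e = e'"
  using level_strict_antimono[of e e' lam] level_strict_antimono[of e' e lam] assms
  by (cases e e' rule: linorder_cases) auto

lemma continuous_on_orbit:
  assumes "lam > 0" "continuous_on S f" "continuous_on S g"
  shows "continuous_on S (\<lambda>x. orbit lam (f x) (g x))"
  unfolding orbit_def using assms by (intro continuous_on_newton_flow continuous_intros) auto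

context
  fixes lam e :: real
  assumes e: "0 < e" "e < lam / 2"
begin

lemma root_gap_nonneg: "0 \<le> root_gap lam e"
  and root_gap_sq: "(root_gap lam e)\<^sup>2 = 9 / 4 * lam\<^sup>2 + 3 * lam * e - 3 * e\<^sup>2"
proof -
  have "0 \<le> 3 * e * (lam - e)" using e by (intro mult_nonneg_nonneg) auto
  moreover have "3 * e * (lam - e) = 3 * lam * e - 3 * e\<^sup>2"
    by (simp add: algebra_simps power2_eq_square)
  ultimately have "0 \<le> 9 / 4 * lam\<^sup>2 + 3 * lam * e - 3 * e\<^sup>2"
    using zero_le_power2[of lam] by linarith
  then show "0 \<le> root_gap lam e" "(root_gap lam e)\<^sup>2 = 9 / 4 * lam\<^sup>2 + 3 * lam * e - 3 * e\<^sup>2"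
    by (simp_all add: root_gap_def)
qed

lemma amplitude_bounds:
  shows "0 < amplitude lam e" "amplitude lam e < root_gap lam e" "e + amplitude lam e \<le> 2 * lam"
    "amplitude lam e * (root_gap lam e - amplitude lam e) = 3 * e * (lam - e)"
proof -
  let ?D = "root_gap lam e"
  note D0 = root_gap_nonneg
  have pos: "0 < 12 * e * (lam - e)" using e by (intro mult_pos_pos) auto
  show "0 < amplitude lam e" using e D0 by (simp add: amplitude_def)
  have "(3 / 2 * lam - 3 * e)\<^sup>2 < ?D\<^sup>2"
    unfolding root_gap_sq using pos by (simp add: algebra_simps power2_eq_square)
  then have "3 / 2 * lam - 3 * e < ?D" using D0 by (rule power2_less_imp_less)
  then show "amplitude lam e < ?D" by (simp add: amplitude_def)
  have "?D\<^sup>2 \<le> (2 * lam)\<^sup>2"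
  proof -
    have "0 \<le> 3 * (lam / 2 - e)\<^sup>2 + lam\<^sup>2" by simp
    then show ?thesis unfolding root_gap_sq by (simp add: algebra_simps power2_eq_square)
  qed
  then have "?D \<le> 2 * lam" by (rule power2_le_imp_le) (use e in auto)
  then show "e + amplitude lam e \<le> 2 * lam" using e by (simp add: amplitude_def)
  have "amplitude lam e * (?D - amplitude lam e) = ?D\<^sup>2 / 4 - (3 / 4 * lam - 3 / 2 * e)\<^sup>2"
    by (simp add: amplitude_def algebra_simps power2_eq_square)
  also have "\<dots> = 3 * e * (lam - e)"
    unfolding root_gap_sq by (simp add: field_simps power2_eq_square)
  finally show "amplitude lam e * (?D - amplitude lam e) = 3 * e * (lam - e)" .
qed

lemma angular_speed_bounds:
  shows "0 < angular_speed lam e \<theta>"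
    "sqrt ((root_gap lam e - amplitude lam e) / 6) \<le> angular_speed lam e \<theta>"
    "angular_speed lam e \<theta> \<le> sqrt (root_gap lam e / 6)"
    "(angular_speed lam e \<theta>)\<^sup>2 = (root_gap lam e - amplitude lam e * (cos \<theta>)\<^sup>2) / 6"
proof -
  have c: "(cos \<theta>)\<^sup>2 \<le> 1" by (simp add: abs_square_le_1)
  have B: "amplitude lam e * (cos \<theta>)\<^sup>2 \<le> amplitude lam e"
    using mult_left_mono[OF c, of "amplitude lam e"] amplitude_bounds(1) by simp
  show low: "sqrt ((root_gap lam e - amplitude lam e) / 6) \<le> angular_speed lam e \<theta>"
    using B by (simp add: angular_speed_def)
  have "0 < sqrt ((root_gap lam e - amplitude lam e) / 6)" using amplitude_bounds by simp
  with low show "0 < angular_speed lam e \<theta>" by linarith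
  show "angular_speed lam e \<theta> \<le> sqrt (root_gap lam e / 6)"
    using amplitude_bounds(1) by (simp add: angular_speed_def)
  show "(angular_speed lam e \<theta>)\<^sup>2 = (root_gap lam e - amplitude lam e * (cos \<theta>)\<^sup>2) / 6"
    using B amplitude_bounds(2) by (simp add: angular_speed_def)
qed

lemma angular_speed_deriv:
  "(angular_speed lam e has_real_derivative
     amplitude lam e * sin \<theta> * cos \<theta> / (6 * angular_speed lam e \<theta>)) (at \<theta>)"
proof -
  have pos: "0 < (root_gap lam e - amplitude lam e * (cos \<theta>)\<^sup>2) / 6"
    using angular_speed_bounds(1)[of \<theta>] by (simp add: angular_speed_def)
  have "((\<lambda>\<theta>. (root_gap lam e - amplitude lam e * (cos \<theta>)\<^sup>2) / 6) has_real_derivative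
      amplitude lam e * sin \<theta> * cos \<theta> / 3) (at \<theta>)"
    by (auto intro!: derivative_eq_intros)
  from DERIV_chain2[OF DERIV_real_sqrt[OF pos] this]
  show ?thesis
    unfolding angular_speed_def[abs_def] by (rule DERIV_cong) (simp add: field_simps)
qed

text \<open>The orbit drawn with \<open>\<theta>\<close> as parameter; \<open>\<theta> = 0\<close> is the inner turning point.\<close>

definition angle_curve :: "real \<Rightarrow> real \<times> real" where
  "angle_curve \<theta> = (- e - amplitude lam e * (sin \<theta>)\<^sup>2,
     - 2 * amplitude lam e * sin \<theta> * cos \<theta> * angular_speed lam e \<theta>)"

lemma angle_curve_range: "fst (angle_curve \<theta>) \<in> {- (2 * lam).. - e}"
proof -
  have "amplitude lam e * (sin \<theta>)\<^sup>2 \<le> amplitude lam e" "0 \<le> amplitude lam e * (sin \<theta>)\<^sup>2"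
    using amplitude_bounds(1) by (auto intro!: mult_left_le simp: abs_square_le_1)
  then show ?thesis
    unfolding angle_curve_def fst_conv atLeastAtMost_iff using amplitude_bounds(3) by linarith
qed

text \<open>The curve solves the equations of motion with time rescaled by \<open>1 / \<theta>'\<close>. For the second component
the claim is an identity between quadratic polynomials in \<open>sin\<^sup>2 \<theta>\<close>; the constant terms agree by
\<open>B (D - B) = 3 e (\<lambda> - e)\<close> and the linear ones by \<open>4 B - 2 D = 3 \<lambda> - 6 e\<close>.\<close>

lemma angle_curve_deriv:
  "(angle_curve has_vector_derivative
     (1 / angular_speed lam e \<theta>) *\<^sub>R newton_field (2 * lam) lam (angle_curve \<theta>)) (at \<theta>)"
proof -
  let ?B = "amplitude lam e" and ?D = "root_gap lam e" and ?w = "angular_speed lam e \<theta>"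
  let ?s = "sin \<theta>" and ?c = "cos \<theta>"
  have w: "?w > 0" by (rule angular_speed_bounds)
  have c2: "?c\<^sup>2 = 1 - ?s\<^sup>2" by (simp add: cos_squared_eq)
  have cut: "cut (2 * lam) (fst (angle_curve \<theta>)) = fst (angle_curve \<theta>)"
    using angle_curve_range[of \<theta>] e by (intro cut_eq) auto
  have 1: "((\<lambda>\<theta>. - e - ?B * (sin \<theta>)\<^sup>2) has_real_derivative
      (1 / ?w) * snd (angle_curve \<theta>)) (at \<theta>)"
    using w by (auto intro!: derivative_eq_intros simp: angle_curve_def)
  have "((\<lambda>\<theta>. - 2 * ?B * sin \<theta> * cos \<theta> * angular_speed lam e \<theta>) has_real_derivative
      - 2 * ?B * (?c\<^sup>2 - ?s\<^sup>2) * ?w - 2 * ?B * ?s * ?c * (?B * ?s * ?c / (6 * ?w))) (at \<theta>)"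
    by (auto intro!: derivative_eq_intros angular_speed_deriv simp: algebra_simps power2_eq_square)
  also have "- 2 * ?B * (?c\<^sup>2 - ?s\<^sup>2) * ?w - 2 * ?B * ?s * ?c * (?B * ?s * ?c / (6 * ?w))
      = (1 / ?w) * (- 2 * ?B * (?c\<^sup>2 - ?s\<^sup>2) * ?w\<^sup>2 - ?B\<^sup>2 * ?s\<^sup>2 * ?c\<^sup>2 / 3)"
    using w by (simp add: field_simps power2_eq_square)
  also have "- 2 * ?B * (?c\<^sup>2 - ?s\<^sup>2) * ?w\<^sup>2 - ?B\<^sup>2 * ?s\<^sup>2 * ?c\<^sup>2 / 3
      = - (?B * (?D - ?B)) / 3 - ?B * ?s\<^sup>2 * (4 * ?B - 2 * ?D) / 3 + (?B * ?s\<^sup>2)\<^sup>2"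
    unfolding angular_speed_bounds(4) c2 by (simp add: field_simps power2_eq_square)
  also have "4 * ?B - 2 * ?D = 3 * lam - 6 * e" by (simp add: amplitude_def)
  also have "- (?B * (?D - ?B)) / 3 - ?B * ?s\<^sup>2 * (3 * lam - 6 * e) / 3 + (?B * ?s\<^sup>2)\<^sup>2
      = fst (angle_curve \<theta>) * (fst (angle_curve \<theta>) + lam)"
    unfolding amplitude_bounds(4) by (simp add: angle_curve_def field_simps power2_eq_square)
  finally have 2: "((\<lambda>\<theta>. - 2 * ?B * sin \<theta> * cos \<theta> * angular_speed lam e \<theta>) has_real_derivative
      (1 / ?w) * (fst (angle_curve \<theta>) * (fst (angle_curve \<theta>) + lam))) (at \<theta>)" .
  show ?thesis
    unfolding angle_curve_def[abs_def]
    using has_vector_derivative_Pair[OF 1[unfolded has_real_derivative_iff_has_vector_derivative]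
        2[unfolded has_real_derivative_iff_has_vector_derivative]] cut
    by (simp add: newton_field_def angle_curve_def)
qed

lemma continuous_inverse_angular_speed: "continuous_on S (\<lambda>\<theta>. 1 / angular_speed lam e \<theta>)"
proof -
  have "continuous_on S (angular_speed lam e)"
    unfolding angular_speed_def[abs_def] by (intro continuous_intros) auto
  then show ?thesis
    using angular_speed_bounds(1) by (intro continuous_intros) (auto simp: less_imp_neq[symmetric])
qed

text \<open>\<open>G \<theta>\<close> is the time at which the orbit has the angle \<open>\<theta>\<close>. Comparing \<open>orbit (G \<theta>)\<close> with the explicit curve,
as solutions of one non-autonomous equation in \<open>\<theta>\<close>, avoids inverting the elliptic integral \<open>G\<close>.\<close>

lemma time_of_angle:
  obtains G where "G 0 = 0" "\<And>\<theta>. (G has_real_derivative 1 / angular_speed lam e \<theta>) (at \<theta>)"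
    "G pi = period lam e" "surj G" "\<And>\<theta>. orbit lam e (G \<theta>) = angle_curve \<theta>"
proof -
  obtain G where G0: "G 0 = 0"
    and G: "\<And>\<theta>. (G has_real_derivative 1 / angular_speed lam e \<theta>) (at \<theta>)"
    using exists_antiderivative[OF continuous_inverse_angular_speed]
    unfolding has_real_derivative_iff_has_vector_derivative by blast
  have "((\<lambda>\<theta>. 1 / angular_speed lam e \<theta>) has_integral (G pi - G 0)) {0..pi}"
    using G by (intro fundamental_theorem_of_calculus)
      (auto intro: has_field_derivative_at_within simp flip: has_real_derivative_iff_has_vector_derivative)
  then have "G pi = period lam e"
    by (simp add: period_def integral_unique G0)
  moreover have "surj G"
  proof -
    define c where "c = 1 / sqrt (root_gap lam e / 6)"
    have c: "c > 0" using amplitude_bounds(1,2) by (simp add: c_def)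
    have mono: "G x - c * x \<le> G y - c * y" if "x \<le> y" for x y
    proof (rule DERIV_nonneg_imp_nondecreasing[OF that], intro exI conjI)
      fix \<theta>
      show "((\<lambda>x. G x - c * x) has_real_derivative 1 / angular_speed lam e \<theta> - c) (at \<theta>)"
        by (auto intro!: derivative_eq_intros G)
      show "0 \<le> 1 / angular_speed lam e \<theta> - c"
        using angular_speed_bounds(1,3)[of \<theta>] by (simp add: c_def frac_le)
    qed
    have "\<exists>\<theta>. G \<theta> = t" for t
    proof -
      have "c * (\<bar>t\<bar> / c) \<le> G (\<bar>t\<bar> / c)" "G (- (\<bar>t\<bar> / c)) \<le> c * (- (\<bar>t\<bar> / c))"
        using mono[of 0 "\<bar>t\<bar> / c"] mono[of "- (\<bar>t\<bar> / c)" 0] c G0 by auto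
      then have "t \<le> G (\<bar>t\<bar> / c)" "G (- (\<bar>t\<bar> / c)) \<le> t" using c by auto
      moreover have "continuous_on {- (\<bar>t\<bar> / c)..\<bar>t\<bar> / c} G"
        using G by (intro DERIV_continuous_on) (rule has_field_derivative_at_within)
      ultimately show ?thesis
        using IVT'[of G "- (\<bar>t\<bar> / c)" t "\<bar>t\<bar> / c"] c by (metis divide_nonneg_pos abs_ge_zero neg_le_0_iff_le order_trans)
    qed
    then show ?thesis by (metis surjI surj_def)
  qed
  moreover have "orbit lam e (G \<theta>) = angle_curve \<theta>" for \<theta>
  proof -
    have lam: "2 * lam > 0" using e by simp
    let ?F = "newton_field (2 * lam) lam"
    define m where "m = 1 / sqrt ((root_gap lam e - amplitude lam e) / 6)"
    have "orbit lam e (G \<theta>) - angle_curve \<theta> = 0"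
    proof (rule zero_if_derivative_dominated[where d = "\<lambda>\<theta>. orbit lam e (G \<theta>) - angle_curve \<theta>"])
      fix \<theta>
      have "(G has_vector_derivative 1 / angular_speed lam e \<theta>) (at \<theta>)"
        using G by (simp add: has_real_derivative_iff_has_vector_derivative)
      from vector_diff_chain_at[OF this newton_flow_deriv[OF lam]]
      have "((\<lambda>\<theta>. orbit lam e (G \<theta>)) has_vector_derivative
          (1 / angular_speed lam e \<theta>) *\<^sub>R ?F (orbit lam e (G \<theta>))) (at \<theta>)"
        unfolding orbit_def by (simp add: o_def)
      from has_vector_derivative_diff[OF this angle_curve_deriv]
      show "((\<lambda>\<theta>. orbit lam e (G \<theta>) - angle_curve \<theta>) has_vector_derivative
          (1 / angular_speed lam e \<theta>) *\<^sub>R (?F (orbit lam e (G \<theta>)) - ?F (angle_curve \<theta>))) (at \<theta>)"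
        by (simp add: scaleR_diff_right)
      have "1 / angular_speed lam e \<theta> \<le> m"
        unfolding m_def using angular_speed_bounds(2)[of \<theta>] amplitude_bounds(2)
        by (intro divide_left_mono mult_pos_pos angular_speed_bounds(1)) auto
      then show "norm ((1 / angular_speed lam e \<theta>) *\<^sub>R (?F (orbit lam e (G \<theta>)) - ?F (angle_curve \<theta>)))
          \<le> (m * newton_lip (2 * lam) lam) * norm (orbit lam e (G \<theta>) - angle_curve \<theta>)"
        using angular_speed_bounds(1)[of \<theta>] order_trans[OF _ \<open>1 / angular_speed lam e \<theta> \<le> m\<close>, of 0]
          mult_mono[OF _ newton_field_lipschitz[OF lam, of lam "orbit lam e (G \<theta>)" "angle_curve \<theta>"],
            of "1 / angular_speed lam e \<theta>" m]
        by (simp add: mult.assoc)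
    qed (simp add: G0 orbit_def newton_flow_0[OF lam] angle_curve_def)
    then show ?thesis by simp
  qed
  ultimately show ?thesis using that G0 G by blast
qed

lemma orbit_range: "fst (orbit lam e t) \<in> {- (2 * lam).. - e}"
proof -
  obtain G where "surj G" "\<And>\<theta>. orbit lam e (G \<theta>) = angle_curve \<theta>"
    by (rule time_of_angle) blast
  then show ?thesis using angle_curve_range by (metis surjD)
qed

lemma orbit_add: "orbit lam e (s + t) = newton_flow (2 * lam) lam t (orbit lam e s)"
  using e by (simp add: orbit_def newton_flow_add)

lemma orbit_periodic: "orbit lam e (t + real n * period lam e) = orbit lam e t"
proof -
  have "orbit lam e (period lam e) = (- e, 0)"
  proof -
    obtain G where "G pi = period lam e" "\<And>\<theta>. orbit lam e (G \<theta>) = angle_curve \<theta>"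
      by (rule time_of_angle) blast
    from this(2)[of pi] this(1) show ?thesis by (simp add: angle_curve_def)
  qed
  then have *: "orbit lam e (period lam e + t) = orbit lam e t" for t
    unfolding orbit_add by (simp add: orbit_def)
  show ?thesis
  proof (induction n)
    case (Suc n)
    then show ?case using *[of "t + real n * period lam e"] by (simp add: algebra_simps)
  qed simp
qed

lemma orbit_reflect: "reflect (orbit lam e t) = orbit lam e (- t)"
  using e by (simp add: orbit_def newton_flow_reflect) (simp add: reflect_def)

lemma orbit_energy: "energy lam (orbit lam e t) = level lam e"
  unfolding orbit_def level_def
proof (rule newton_flow_energy[where S = UNIV])
  show "fst (newton_flow (2 * lam) lam s (- e, 0)) \<in> {- (2 * lam)..0}" for s
    using orbit_range[of s] e by (auto simp: orbit_def)
qed (use e in auto)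

end

text \<open>The square of the speed is, up to the factor \<open>6\<close>,
\<open>root_gap * (1 - cos\<^sup>2 \<theta> / 2) - (3/4 \<lambda> - 3/2 e) cos\<^sup>2 \<theta>\<close>. Both summands grow with \<open>e\<close>, the first one
because \<open>root_gap\<close> increases up to \<open>e = \<lambda> / 2\<close>.\<close>

lemma angular_speed_strict_mono:
  assumes "0 < e" "e < e'" "e' < lam / 2"
  shows "angular_speed lam e \<theta> < angular_speed lam e' \<theta>"
proof -
  have "0 < (e' - e) * (3 * (lam - e - e'))"
    using assms by (intro mult_pos_pos) auto
  then have "(root_gap lam e)\<^sup>2 < (root_gap lam e')\<^sup>2"
    using root_gap_sq[of e lam] root_gap_sq[of e' lam] assms
    by (simp add: algebra_simps power2_eq_square)
  moreover have "0 \<le> root_gap lam e'"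
    using amplitude_bounds[of e' lam] assms by simp
  ultimately have gap: "root_gap lam e < root_gap lam e'" by (rule power2_less_imp_less)
  have c: "(cos \<theta>)\<^sup>2 \<le> 1" by (simp add: abs_square_le_1)
  have split: "root_gap lam x - amplitude lam x * (cos \<theta>)\<^sup>2 =
      root_gap lam x * (1 - (cos \<theta>)\<^sup>2 / 2) - (3 / 4 * lam - 3 / 2 * x) * (cos \<theta>)\<^sup>2" for x
    by (simp add: amplitude_def algebra_simps)
  have "root_gap lam e * (1 - (cos \<theta>)\<^sup>2 / 2) < root_gap lam e' * (1 - (cos \<theta>)\<^sup>2 / 2)"
    using gap c by (intro mult_strict_right_mono) auto
  moreover have "(3 / 4 * lam - 3 / 2 * e') * (cos \<theta>)\<^sup>2 \<le> (3 / 4 * lam - 3 / 2 * e) * (cos \<theta>)\<^sup>2"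
    using assms by (intro mult_right_mono) auto
  ultimately show ?thesis
    unfolding angular_speed_def split by simp
qed

text \<open>The twist of the first phase. The difference of the two elapsed times is strictly increasing in
\<open>\<theta>\<close>, since the speeds are ordered at every angle.\<close>

lemma period_strict_antimono:
  assumes "0 < e" "e < e'" "e' < lam / 2"
  shows "period lam e' < period lam e"
proof -
  have e: "0 < e" "e < lam / 2" and e': "0 < e'" "e' < lam / 2" using assms by auto
  obtain G where G: "G 0 = 0" "\<And>\<theta>. (G has_real_derivative 1 / angular_speed lam e \<theta>) (at \<theta>)"
    "G pi = period lam e"
    by (rule time_of_angle[OF e]) blast
  obtain G' where G': "G' 0 = 0" "\<And>\<theta>. (G' has_real_derivative 1 / angular_speed lam e' \<theta>) (at \<theta>)"
    "G' pi = period lam e'"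
    by (rule time_of_angle[OF e']) blast
  have "G 0 - G' 0 < G pi - G' pi"
  proof (rule DERIV_pos_imp_increasing[OF pi_gt_zero], intro exI conjI)
    fix \<theta>
    show "((\<lambda>\<theta>. G \<theta> - G' \<theta>) has_real_derivative
        1 / angular_speed lam e \<theta> - 1 / angular_speed lam e' \<theta>) (at \<theta>)"
      by (intro DERIV_diff G G')
    show "0 < 1 / angular_speed lam e \<theta> - 1 / angular_speed lam e' \<theta>"
      using angular_speed_strict_mono[OF assms, of \<theta>] angular_speed_bounds(1)[OF e, of \<theta>]
      by (simp add: frac_less2)
  qed
  then show ?thesis using G G' by simp
qed

lemma period_pos:
  assumes "0 < e" "e < lam / 2"
  shows "0 < period lam e"
proof -
  obtain G where G: "G 0 = 0" "\<And>\<theta>. (G has_real_derivative 1 / angular_speed lam e \<theta>) (at \<theta>)"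
    "G pi = period lam e"
    by (rule time_of_angle[OF assms]) blast
  have "G 0 < G pi"
    by (rule DERIV_pos_imp_increasing[OF pi_gt_zero])
       (use G(2) angular_speed_bounds(1)[OF assms] in force)
  then show ?thesis using G by simp
qed

lemma continuous_on_period: "continuous_on {0<..<lam / 2} (period lam)"
proof -
  have "continuous_on ({0<..<lam / 2} \<times> cbox 0 pi) (\<lambda>p. angular_speed lam (fst p) (snd p))"
    unfolding angular_speed_def root_gap_def amplitude_def by (intro continuous_intros) auto
  moreover have "angular_speed lam (fst p) (snd p) \<noteq> 0" if "p \<in> {0<..<lam / 2} \<times> cbox 0 pi" for p
    using angular_speed_bounds(1)[of "fst p" lam "snd p"] that by force
  ultimately have "continuous_on ({0<..<lam / 2} \<times> cbox 0 pi) (\<lambda>(e, \<theta>). 1 / angular_speed lam e \<theta>)"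
    unfolding case_prod_beta by (intro continuous_intros) auto
  from integral_continuous_on_param[OF this] show ?thesis
    by (simp add: period_def[abs_def])
qed

section \<open>The second phase near an inner turning point\<close>

text \<open>The rate \<open>x x'\<close> at which \<open>x\<^sup>2 / 2\<close> changes along any motion; it governs the exchange of energy during
the second phase.\<close>

definition half_square_rate :: "real \<times> real \<Rightarrow> real" where
  "half_square_rate z = fst z * snd z"

lemma mem_cball_pair:
  fixes p :: "real \<times> real"
  assumes "p \<in> cball (x, y) r"
  shows "\<bar>fst p - x\<bar> \<le> r" "\<bar>snd p - y\<bar> \<le> r"
proof -
  have "norm (p - (x, y)) \<le> r" using assms by (simp add: dist_norm norm_minus_commute)
  moreover have "\<bar>fst p - x\<bar> \<le> norm (p - (x, y))" "\<bar>snd p - y\<bar> \<le> norm (p - (x, y))"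
    by (metis fst_conv fst_diff norm_fst_le prod.collapse real_norm_def)
       (metis snd_conv snd_diff norm_snd_le prod.collapse real_norm_def)
  ultimately show "\<bar>fst p - x\<bar> \<le> r" "\<bar>snd p - y\<bar> \<le> r" by linarith+
qed

text \<open>Near the inner turning point an energy level is almost parallel to the \<open>v\<close>-axis. On a chord of a level the
term \<open>x (v - v')\<close> therefore dominates the change of \<open>x v\<close>, which is strictly decreasing in \<open>v\<close>. Working
with chords instead of tangents gives the estimate for pairs of points, as the flow of the second phase
requires. The disc is so small that \<open>x\<close> stays within \<open>\<lambda> / 16\<close> of \<open>- \<lambda> / 4\<close>, and the bound on
\<open>\<epsilon>\<^sup>2\<close> makes the contribution of the slope of the chord small against \<open>\<bar>x\<bar>\<close>.\<close>

lemma level_chord: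
  fixes z w :: "real \<times> real"
  assumes lam: "lam > 0" and \<epsilon>: "0 < \<epsilon>" "\<epsilon> \<le> lam / 16" "\<epsilon>\<^sup>2 \<le> lam ^ 3 / 256"
    and z: "z \<in> cball (- (lam / 4), 0) \<epsilon>" and w: "w \<in> cball (- (lam / 4), 0) \<epsilon>"
    and en: "energy lam z = energy lam w"
  shows "\<bar>fst z - fst w\<bar> \<le> 8 * \<epsilon> / lam\<^sup>2 * \<bar>snd z - snd w\<bar>"
    and "snd z \<le> snd w \<Longrightarrow> lam / 8 * (snd w - snd z) \<le> half_square_rate z - half_square_rate w"
proof -
  define x v x' v' where xv: "x = fst z" "v = snd z" "x' = fst w" "v' = snd w"
  have x: "- x \<in> {3 / 16 * lam..5 / 16 * lam}" and x': "- x' \<in> {3 / 16 * lam..5 / 16 * lam}"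
    and v: "\<bar>v\<bar> \<le> \<epsilon>" "\<bar>v'\<bar> \<le> \<epsilon>"
    using mem_cball_pair[OF z] mem_cball_pair[OF w] \<epsilon> unfolding xv by auto
  define br where "br = 2 / 3 * (x\<^sup>2 + x * x' + x'\<^sup>2) + lam * (x + x')"
  have "br \<le> - (lam\<^sup>2 / 4)"
  proof -
    have 1: "x\<^sup>2 \<le> 5 / 16 * lam * (- x)"
      using x lam mult_right_mono[of "- x" "5 / 16 * lam" "- x"] by (simp add: power2_eq_square)
    have 2: "x'\<^sup>2 \<le> 5 / 16 * lam * (- x')"
      using x' lam mult_right_mono[of "- x'" "5 / 16 * lam" "- x'"] by (simp add: power2_eq_square)
    have 3: "2 * (x * x') \<le> x\<^sup>2 + x'\<^sup>2"
      using zero_le_power2[of "x - x'"] by (simp add: power2_diff)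
    have 4: "lam * (3 / 8 * lam) \<le> lam * (- x - x')"
      using x x' lam by (intro mult_left_mono) auto
    have "x\<^sup>2 + x'\<^sup>2 \<le> 5 / 16 * (lam * (- x - x'))"
      using 1 2 by (simp add: algebra_simps)
    moreover have "2 / 3 * (x\<^sup>2 + x * x' + x'\<^sup>2) \<le> x\<^sup>2 + x'\<^sup>2"
      using 3 by argo
    moreover have "br = 2 / 3 * (x\<^sup>2 + x * x' + x'\<^sup>2) - lam * (- x - x')"
      by (simp add: br_def algebra_simps)
    moreover have "3 / 8 * lam\<^sup>2 \<le> lam * (- x - x')"
      using 4 by (simp add: power2_eq_square)
    ultimately show ?thesis using zero_le_power2[of lam] by linarith
  qed
  have "v'\<^sup>2 - v\<^sup>2 = (x - x') * (- br)"
    using en unfolding energy_def xv[symmetric] br_def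
    by (simp add: field_simps power2_eq_square power3_eq_cube)
  then have "\<bar>x - x'\<bar> * (- br) = \<bar>v'\<^sup>2 - v\<^sup>2\<bar>"
    using order_trans[OF \<open>br \<le> - (lam\<^sup>2 / 4)\<close>, of 0] by (simp add: abs_mult abs_of_nonpos)
  also have "\<bar>v'\<^sup>2 - v\<^sup>2\<bar> = \<bar>v' + v\<bar> * \<bar>v - v'\<bar>"
    by (simp add: abs_mult[symmetric] power2_eq_square algebra_simps abs_minus_commute)
  also have "\<dots> \<le> (2 * \<epsilon>) * \<bar>v - v'\<bar>"
    using v by (intro mult_right_mono) auto
  finally have "\<bar>x - x'\<bar> * (- br) \<le> (2 * \<epsilon>) * \<bar>v - v'\<bar>" .
  moreover have "\<bar>x - x'\<bar> * (lam\<^sup>2 / 4) \<le> \<bar>x - x'\<bar> * (- br)"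
    using \<open>br \<le> - (lam\<^sup>2 / 4)\<close> by (intro mult_left_mono) auto
  ultimately have "\<bar>x - x'\<bar> * (lam\<^sup>2 / 4) \<le> (2 * \<epsilon>) * \<bar>v - v'\<bar>" by linarith
  then have chord: "\<bar>x - x'\<bar> \<le> 8 * \<epsilon> / lam\<^sup>2 * \<bar>v - v'\<bar>"
    using lam by (simp add: field_simps)
  then show "\<bar>fst z - fst w\<bar> \<le> 8 * \<epsilon> / lam\<^sup>2 * \<bar>snd z - snd w\<bar>" by (simp add: xv)
  assume "snd z \<le> snd w"
  then have vv: "v \<le> v'" by (simp add: xv)
  have "\<bar>v' * (x - x')\<bar> \<le> \<epsilon> * (8 * \<epsilon> / lam\<^sup>2 * \<bar>v - v'\<bar>)"
    unfolding abs_mult using v chord \<epsilon> by (intro mult_mono) auto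
  also have "\<dots> = 8 * \<epsilon>\<^sup>2 / lam\<^sup>2 * (v' - v)"
    using vv by (simp add: power2_eq_square)
  also have "\<dots> \<le> lam / 32 * (v' - v)"
  proof (rule mult_right_mono)
    have "8 * \<epsilon>\<^sup>2 \<le> lam / 32 * lam\<^sup>2" using \<epsilon>(3) by (simp add: power2_eq_square power3_eq_cube)
    then show "8 * \<epsilon>\<^sup>2 / lam\<^sup>2 \<le> lam / 32" using lam by (simp add: divide_le_eq)
  qed (use vv in auto)
  finally have 1: "\<bar>v' * (x - x')\<bar> \<le> lam / 32 * (v' - v)" .
  have 2: "3 / 16 * lam * (v' - v) \<le> (- x) * (v' - v)"
    using x vv by (intro mult_right_mono) auto
  have 3: "half_square_rate z - half_square_rate w = (- x) * (v' - v) + v' * (x - x')"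
    by (simp add: half_square_rate_def xv algebra_simps)
  have 4: "0 \<le> lam * (v' - v)" using lam vv by simp
  show "lam / 8 * (snd w - snd z) \<le> half_square_rate z - half_square_rate w"
  proof -
    have "lam / 32 * (v' - v) = lam * (v' - v) / 32" "3 / 16 * lam * (v' - v) = 3 * (lam * (v' - v)) / 16"
      "lam / 8 * (v' - v) = lam * (v' - v) / 8" by simp_all
    then show ?thesis
      unfolding 3 xv(2,4)[symmetric] using 1 2 4 abs_ge_minus_self[of "v' * (x - x')"] by linarith
  qed
qed

text \<open>The derivative of \<open>x v\<close> along the second phase is \<open>v\<^sup>2 + x\<^sup>2 (x + \<mu>)\<close>. Its Lipschitz constant near the
turning point controls how fast the separation of two values of \<open>x v\<close> can change.\<close>

lemma half_square_rate_deriv_lipschitz: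
  fixes p p' :: "real \<times> real" and mu lam \<epsilon> :: real
  assumes p: "p \<in> cball (- (lam / 4), 0) \<epsilon>" and p': "p' \<in> cball (- (lam / 4), 0) \<epsilon>"
    and \<epsilon>: "0 < \<epsilon>" "\<epsilon> \<le> lam / 16"
  shows "\<bar>((snd p)\<^sup>2 + (fst p)\<^sup>2 * (fst p + mu)) - ((snd p')\<^sup>2 + (fst p')\<^sup>2 * (fst p' + mu))\<bar>
    \<le> (2 * \<epsilon> + 3 * lam\<^sup>2 + 2 * lam * \<bar>mu\<bar>) * norm (p - p')"
proof -
  obtain x v where pe: "p = (x, v)" by (cases p)
  obtain x' v' where pe': "p' = (x', v')" by (cases p')
  have x: "\<bar>x\<bar> \<le> lam" "\<bar>x'\<bar> \<le> lam" and v: "\<bar>v\<bar> \<le> \<epsilon>" "\<bar>v'\<bar> \<le> \<epsilon>"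
    using mem_cball_pair[OF p] mem_cball_pair[OF p'] \<epsilon> by (auto simp: pe pe')
  have n: "\<bar>x - x'\<bar> \<le> norm (p - p')" "\<bar>v - v'\<bar> \<le> norm (p - p')"
    using norm_fst_le[of "x - x'" "v - v'"] norm_snd_le[of "v - v'" "x - x'"] by (auto simp: pe pe')
  have "\<bar>v\<^sup>2 - v'\<^sup>2\<bar> = \<bar>v + v'\<bar> * \<bar>v - v'\<bar>"
    by (simp add: abs_mult[symmetric] power2_eq_square algebra_simps)
  also have "\<dots> \<le> (2 * \<epsilon>) * norm (p - p')" using v n by (intro mult_mono) auto
  finally have 1: "\<bar>v\<^sup>2 - v'\<^sup>2\<bar> \<le> (2 * \<epsilon>) * norm (p - p')" .
  have lam: "0 \<le> lam" using \<epsilon> by simp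
  have sq: "\<bar>x\<^sup>2 + x * x' + x'\<^sup>2\<bar> \<le> 3 * lam\<^sup>2"
  proof -
    have "\<bar>x\<^sup>2\<bar> \<le> lam\<^sup>2" "\<bar>x * x'\<bar> \<le> lam\<^sup>2" "\<bar>x'\<^sup>2\<bar> \<le> lam\<^sup>2"
      using x lam mult_mono[of "\<bar>x\<bar>" lam "\<bar>x\<bar>" lam] mult_mono[of "\<bar>x\<bar>" lam "\<bar>x'\<bar>" lam]
        mult_mono[of "\<bar>x'\<bar>" lam "\<bar>x'\<bar>" lam]
      unfolding power2_eq_square abs_mult by auto
    then show ?thesis by linarith
  qed
  have "\<bar>x\<^sup>2 * (x + mu) - x'\<^sup>2 * (x' + mu)\<bar> = \<bar>(x\<^sup>2 + x * x' + x'\<^sup>2) + mu * (x + x')\<bar> * \<bar>x - x'\<bar>"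
    unfolding abs_mult[symmetric] by (simp add: power2_eq_square algebra_simps)
  also have "\<dots> \<le> (3 * lam\<^sup>2 + \<bar>mu\<bar> * (2 * lam)) * norm (p - p')"
  proof (rule mult_mono)
    have "\<bar>mu * (x + x')\<bar> \<le> \<bar>mu\<bar> * (2 * lam)"
      unfolding abs_mult using x by (intro mult_left_mono) auto
    then show "\<bar>(x\<^sup>2 + x * x' + x'\<^sup>2) + mu * (x + x')\<bar> \<le> 3 * lam\<^sup>2 + \<bar>mu\<bar> * (2 * lam)"
      using sq by linarith
    show "0 \<le> 3 * lam\<^sup>2 + \<bar>mu\<bar> * (2 * lam)" using lam by simp
  qed (use n in auto)
  finally have 2: "\<bar>x\<^sup>2 * (x + mu) - x'\<^sup>2 * (x' + mu)\<bar> \<le> (3 * lam\<^sup>2 + \<bar>mu\<bar> * (2 * lam)) * norm (p - p')" .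
  show ?thesis using 1 2 unfolding pe pe' fst_conv snd_conv by (simp add: distrib_right abs_le_iff algebra_simps)
qed

lemma continuous_near:
  fixes f :: "'a::metric_space \<Rightarrow> 'b::topological_space"
  assumes "continuous_on UNIV f" "open S" "f a \<in> S"
  obtains d where "d > 0" "\<And>x. dist x a < d \<Longrightarrow> f x \<in> S"
proof -
  have "open (f -` S)" using assms(1,2) by (simp add: open_vimage)
  then show ?thesis using assms(3) that unfolding open_dist by auto
qed

context
  fixes lam mu :: real
  assumes lam: "lam > 0" and mu: "mu < lam"
begin

abbreviation (input) "kick \<equiv> newton_flow (2 * lam) mu"

lemma two_lam: "2 * lam > 0" using lam by simp

text \<open>The two energies differ by \<open>(\<lambda> - \<mu>) x\<^sup>2\<close>, and the second phase conserves its own.\<close>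

lemma kick_energy:
  assumes "0 \<le> \<tau>" and range: "\<And>s. s \<in> {0..\<tau>} \<Longrightarrow> fst (kick s z) \<in> {- (2 * lam)..0}"
  shows "energy lam (kick \<tau> z) = energy lam z - (lam - mu) * ((fst (kick \<tau> z))\<^sup>2 - (fst z)\<^sup>2)"
proof -
  have "energy mu (kick \<tau> z) = energy mu z"
    by (rule newton_flow_energy[OF two_lam, of "{0..\<tau>}"]) (use assms in auto)
  then show ?thesis by (simp add: energy_def algebra_simps)
qed

text \<open>The change of the first energy during the second phase is \<open>- 2 (\<lambda> - \<mu>)\<close> times the integral of \<open>x v\<close>.
For two points on one level the values of \<open>x v\<close> are separated by at least \<open>\<lambda> / 8\<close> times the gap in
\<open>v\<close> at the start (\<open>level_chord\<close>), and a short motion changes this separation by a small multiple of the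
same gap. So the energy after the second phase is a strictly increasing function of \<open>v\<close> on each level.

The three concentric discs leave room for two consecutive applications of the short motion, which
the time-reversal argument in \<open>kick_window_exists\<close> requires.\<close>

lemma transversality:
  obtains \<epsilon> \<tau>\<^sub>0 where "0 < \<epsilon>" "\<epsilon> \<le> lam / 16" "0 < \<tau>\<^sub>0"
    "\<And>z t. z \<in> cball (- (lam / 4), 0) (\<epsilon> / 16) \<Longrightarrow> t \<in> {0..\<tau>\<^sub>0} \<Longrightarrow> kick t z \<in> cball (- (lam / 4), 0) (\<epsilon> / 4)"
    "\<And>z t. z \<in> cball (- (lam / 4), 0) (\<epsilon> / 4) \<Longrightarrow> t \<in> {0..\<tau>\<^sub>0} \<Longrightarrow> kick t z \<in> cball (- (lam / 4), 0) \<epsilon>"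
    "\<And>z w \<tau>. \<lbrakk>z \<in> cball (- (lam / 4), 0) (\<epsilon> / 4); w \<in> cball (- (lam / 4), 0) (\<epsilon> / 4);
        energy lam z = energy lam w; 0 < \<tau>; \<tau> \<le> \<tau>\<^sub>0; snd z < snd w\<rbrakk>
      \<Longrightarrow> energy lam (kick \<tau> z) < energy lam (kick \<tau> w)"
    "\<And>z w. \<lbrakk>z \<in> cball (- (lam / 4), 0) (\<epsilon> / 4); w \<in> cball (- (lam / 4), 0) (\<epsilon> / 4);
        energy lam z = energy lam w; snd z = snd w\<rbrakk> \<Longrightarrow> z = w"
proof -
  define z\<^sub>0 :: "real \<times> real" where "z\<^sub>0 = (- (lam / 4), 0)"
  \<comment> \<open>The second entry makes \<open>\<epsilon>\<^sup>2 \<le> \<lambda>\<^sup>3 / 256\<close>; \<open>v\<^sup>2\<close> scales like \<open>\<lambda>\<^sup>3\<close>.\<close>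
  define \<epsilon> where "\<epsilon> = min (lam / 16) (sqrt lam * lam / 16)"
  have \<epsilon>: "0 < \<epsilon>" "\<epsilon> \<le> lam / 16" using lam by (auto simp: \<epsilon>_def)
  have \<epsilon>3: "\<epsilon>\<^sup>2 \<le> lam ^ 3 / 256"
  proof -
    have "\<epsilon>\<^sup>2 \<le> (sqrt lam * lam / 16)\<^sup>2" using \<epsilon>(1) by (intro power_mono) (auto simp: \<epsilon>_def)
    also have "\<dots> = lam ^ 3 / 256"
      using lam by (simp add: power_divide power_mult_distrib power3_eq_cube power2_eq_square[of lam])
    finally show ?thesis .
  qed
  define L where "L = newton_lip (2 * lam) mu"
  define C where "C = 3 * (2 * \<epsilon> + 3 * lam\<^sup>2 + 2 * lam * \<bar>mu\<bar>) * (1 + 8 * \<epsilon> / lam\<^sup>2)"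
  have C: "0 < C" unfolding C_def using \<epsilon> lam
    by (intro mult_pos_pos add_pos_nonneg) auto
  have "continuous_on UNIV (\<lambda>t. 2 * exp (2 * L * \<bar>t\<bar>))" by (intro continuous_intros)
  from continuous_near[OF this, of "{..<3}" 0]
  obtain d1 where d1: "d1 > 0" "\<And>t. dist t 0 < d1 \<Longrightarrow> 2 * exp (2 * L * \<bar>t\<bar>) \<in> {..<3}" by auto
  have "continuous_on UNIV (\<lambda>t. kick t z\<^sub>0)"
    by (intro continuous_on_newton_flow[OF two_lam] continuous_intros)
  from continuous_near[OF this, of "ball z\<^sub>0 (\<epsilon> / 16)" 0] \<epsilon>
  obtain d2 where d2: "d2 > 0" "\<And>t. dist t 0 < d2 \<Longrightarrow> kick t z\<^sub>0 \<in> ball z\<^sub>0 (\<epsilon> / 16)"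
    by (auto simp: newton_flow_0[OF two_lam])
  \<comment> \<open>\<open>\<tau>\<^sub>0 C \<le> \<lambda> / 16\<close> keeps half of the separation \<open>\<lambda> / 8\<close>; up to \<open>d1\<close> distances grow at most by the factor
    \<open>3\<close>, and up to \<open>d2\<close> the centre moves by at most \<open>\<epsilon> / 16\<close>.\<close>
  define \<tau>\<^sub>0 where "\<tau>\<^sub>0 = min (min (d1 / 2) (d2 / 2)) (lam / (16 * C))"
  have \<tau>\<^sub>0: "0 < \<tau>\<^sub>0" "\<tau>\<^sub>0 < d1" "\<tau>\<^sub>0 < d2" "\<tau>\<^sub>0 * C \<le> lam / 16"
  proof -
    show "0 < \<tau>\<^sub>0" "\<tau>\<^sub>0 < d1" "\<tau>\<^sub>0 < d2" using d1(1) d2(1) lam C by (auto simp: \<tau>\<^sub>0_def)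
    have "\<tau>\<^sub>0 \<le> lam / (16 * C)" by (simp add: \<tau>\<^sub>0_def)
    then show "\<tau>\<^sub>0 * C \<le> lam / 16" using C by (simp add: field_simps)
  qed
  have spread: "norm (kick t z - kick t w) \<le> 3 * norm (z - w)" if "t \<in> {0..\<tau>\<^sub>0}" for t z w
  proof -
    have "2 * exp (2 * L * \<bar>t\<bar>) \<le> 3" using d1(2)[of t] that \<tau>\<^sub>0 by auto
    then have "2 * exp (2 * L * \<bar>t\<bar>) * norm (z - w) \<le> 3 * norm (z - w)"
      by (rule mult_right_mono) simp
    then show ?thesis using newton_flow_dependence[OF two_lam, of mu t z w] by (simp add: L_def)
  qed
  have grow: "kick t z \<in> cball z\<^sub>0 (4 * r)" if z: "z \<in> cball z\<^sub>0 r" and t: "t \<in> {0..\<tau>\<^sub>0}" and r: "\<epsilon> / 16 \<le> r" for z t r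
  proof -
    have "norm (kick t z - z\<^sub>0) \<le> norm (kick t z - kick t z\<^sub>0) + norm (kick t z\<^sub>0 - z\<^sub>0)"
      using norm_triangle_ineq[of "kick t z - kick t z\<^sub>0" "kick t z\<^sub>0 - z\<^sub>0"] by simp
    also have "\<dots> \<le> 3 * norm (z - z\<^sub>0) + \<epsilon> / 16"
      using spread[OF t, of z z\<^sub>0] d2(2)[of t] t \<tau>\<^sub>0 by (auto simp: dist_norm norm_minus_commute)
    also have "\<dots> \<le> 4 * r" using z r by (auto simp: dist_norm norm_minus_commute)
    finally show ?thesis by (simp add: dist_norm norm_minus_commute)
  qed
  have near: "kick t z \<in> cball z\<^sub>0 \<epsilon>" if "z \<in> cball z\<^sub>0 (\<epsilon> / 4)" "t \<in> {0..\<tau>\<^sub>0}" for z t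
    using grow[OF that] \<epsilon> by simp
  have range: "fst p \<in> {- (2 * lam)..0}" if "p \<in> cball z\<^sub>0 \<epsilon>" for p
    using mem_cball_pair[of p "- (lam / 4)" 0 \<epsilon>] that \<epsilon> lam by (auto simp: z\<^sub>0_def)
  have sub: "p \<in> cball z\<^sub>0 \<epsilon>" if "p \<in> cball z\<^sub>0 (\<epsilon> / 4)" for p
    using that \<epsilon> by auto
  note chord = level_chord[OF lam \<epsilon> \<epsilon>3, folded z\<^sub>0_def]
  have trans: "energy lam (kick \<tau> z) < energy lam (kick \<tau> w)"
    if z: "z \<in> cball z\<^sub>0 (\<epsilon> / 4)" and w: "w \<in> cball z\<^sub>0 (\<epsilon> / 4)"
      and en: "energy lam z = energy lam w" and \<tau>: "0 < \<tau>" "\<tau> \<le> \<tau>\<^sub>0" and vw: "snd z < snd w"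
    for z w \<tau>
  proof -
    let ?N = "\<lambda>p. (snd p)\<^sup>2 + (fst p)\<^sup>2 * (fst p + mu)"
    let ?v = "snd w - snd z"
    have v: "?v > 0" using vw by simp
    have zw: "norm (z - w) \<le> (1 + 8 * \<epsilon> / lam\<^sup>2) * ?v"
    proof -
      have "norm (z - w) \<le> \<bar>fst z - fst w\<bar> + \<bar>snd z - snd w\<bar>"
        using norm_Pair_le[of "fst (z - w)" "snd (z - w)"] unfolding prod.collapse by simp
      also have "\<dots> \<le> 8 * \<epsilon> / lam\<^sup>2 * \<bar>snd z - snd w\<bar> + \<bar>snd z - snd w\<bar>"
        using chord(1)[OF sub[OF z] sub[OF w] en] by simp
      finally show ?thesis using vw by (simp add: distrib_right)
    qed
    define j where "j t = half_square_rate (kick t z) - half_square_rate (kick t w)" for t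
    have rate_deriv: "((\<lambda>t. half_square_rate (kick t p)) has_real_derivative ?N (kick t p)) (at t)"
      if p: "p \<in> cball z\<^sub>0 (\<epsilon> / 4)" and t: "t \<in> {0..\<tau>\<^sub>0}" for p t
      unfolding half_square_rate_def
      using DERIV_mult[OF newton_flow_deriv_fst[OF two_lam, of mu p t]
          newton_flow_deriv_snd[OF two_lam range[OF near[OF p t]]]]
      by (rule DERIV_cong) (simp add: power2_eq_square algebra_simps)
    have j_deriv: "(j has_real_derivative ?N (kick t z) - ?N (kick t w)) (at t)" if "t \<in> {0..\<tau>\<^sub>0}" for t
      unfolding j_def by (intro DERIV_diff rate_deriv z w that)
    have j_pos: "j t > 0" if t: "t \<in> {0..\<tau>}" for t
    proof -
      have j0: "j 0 \<ge> lam / 8 * ?v"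
        using chord(2)[OF sub[OF z] sub[OF w] en] vw by (simp add: j_def newton_flow_0[OF two_lam])
      have "\<bar>j t - j 0\<bar> \<le> t * C * ?v"
      proof (cases "t = 0")
        case False
        then have t0: "0 < t" "t \<le> \<tau>\<^sub>0" using t \<tau> by auto
        have "norm (j t - j 0) \<le> (C * ?v) * t - (C * ?v) * 0"
        proof (rule differentiable_bound_general[OF t0(1)])
          show "continuous_on {0..t} j"
            using t0 by (intro DERIV_continuous_on[where D = "\<lambda>t. ?N (kick t z) - ?N (kick t w)"]
                has_field_derivative_at_within[OF j_deriv]) auto
          show "(j has_vector_derivative ?N (kick s z) - ?N (kick s w)) (at s)" if "0 < s" "s < t" for s
            using j_deriv[of s] t0 that by (simp add: has_real_derivative_iff_has_vector_derivative)
          show "((\<lambda>s. (C * ?v) * s) has_vector_derivative C * ?v) (at s)" for s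
            unfolding has_real_derivative_iff_has_vector_derivative[symmetric]
            by (auto intro!: derivative_eq_intros)
          show "norm (?N (kick s z) - ?N (kick s w)) \<le> C * ?v" if "0 < s" "s < t" for s
          proof -
            have s: "s \<in> {0..\<tau>\<^sub>0}" using that t0 by auto
            let ?K = "2 * \<epsilon> + 3 * lam\<^sup>2 + 2 * lam * \<bar>mu\<bar>"
            have K: "0 \<le> ?K" using \<epsilon> lam by (intro add_nonneg_nonneg) auto
            have "\<bar>?N (kick s z) - ?N (kick s w)\<bar> \<le> ?K * norm (kick s z - kick s w)"
              using half_square_rate_deriv_lipschitz[of "kick s z" lam \<epsilon> "kick s w" mu]
                near[OF z s] near[OF w s] \<epsilon> by (simp add: z\<^sub>0_def)
            also have "\<dots> \<le> ?K * (3 * ((1 + 8 * \<epsilon> / lam\<^sup>2) * ?v))"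
              using spread[OF s, of z w] zw K by (intro mult_left_mono) auto
            also have "\<dots> = C * ?v"
              unfolding C_def by (simp only: mult.assoc mult.commute mult.left_commute)
            finally show ?thesis by simp
          qed
        qed (intro continuous_intros)
        then show ?thesis by (simp add: mult.commute mult.left_commute)
      qed simp
      moreover have "t * C * ?v \<le> lam / 16 * ?v"
      proof (rule mult_right_mono)
        have "t * C \<le> \<tau>\<^sub>0 * C" using t \<tau> C by (intro mult_right_mono) auto
        then show "t * C \<le> lam / 16" using \<tau>\<^sub>0(4) by linarith
      qed (use v in auto)
      moreover have "0 < lam * ?v" using lam v by simp
      ultimately show ?thesis using j0 by (simp add: abs_le_iff)
    qed
    have "(fst (kick 0 z))\<^sup>2 - (fst (kick 0 w))\<^sup>2 < (fst (kick \<tau> z))\<^sup>2 - (fst (kick \<tau> w))\<^sup>2"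
    proof (rule DERIV_pos_imp_increasing[OF \<tau>(1)], intro exI conjI)
      fix t assume "0 \<le> t" "t \<le> \<tau>"
      show "((\<lambda>t. (fst (kick t z))\<^sup>2 - (fst (kick t w))\<^sup>2) has_real_derivative 2 * j t) (at t)"
      proof -
        have "((\<lambda>t. (fst (kick t p))\<^sup>2) has_real_derivative 2 * half_square_rate (kick t p)) (at t)" for p
          by (auto intro!: derivative_eq_intros newton_flow_deriv_fst[OF two_lam] simp: half_square_rate_def)
        from DERIV_diff[OF this[of z] this[of w]] show ?thesis
          by (simp add: j_def right_diff_distrib)
      qed
      show "0 < 2 * j t" using j_pos \<open>0 \<le> t\<close> \<open>t \<le> \<tau>\<close> by simp
    qed
    then have "(lam - mu) * ((fst (kick \<tau> w))\<^sup>2 - (fst w)\<^sup>2) < (lam - mu) * ((fst (kick \<tau> z))\<^sup>2 - (fst z)\<^sup>2)"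
      using mu by (intro mult_strict_left_mono) (auto simp: newton_flow_0[OF two_lam])
    moreover have "energy lam (kick \<tau> p) = energy lam p - (lam - mu) * ((fst (kick \<tau> p))\<^sup>2 - (fst p)\<^sup>2)"
      if "p \<in> cball z\<^sub>0 (\<epsilon> / 4)" for p
      by (rule kick_energy) (use \<tau> range near[OF that] in auto)
    ultimately show ?thesis using z w en by simp
  qed
  have inj: "z = w" if "z \<in> cball z\<^sub>0 (\<epsilon> / 4)" "w \<in> cball z\<^sub>0 (\<epsilon> / 4)" "energy lam z = energy lam w" "snd z = snd w"
    for z w
    using chord(1)[OF sub[OF that(1)] sub[OF that(2)] that(3)] that(4) by (simp add: prod_eq_iff)
  have near0: "kick t z \<in> cball z\<^sub>0 (\<epsilon> / 4)" if "z \<in> cball z\<^sub>0 (\<epsilon> / 16)" "t \<in> {0..\<tau>\<^sub>0}" for z t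
    using grow[OF that] by simp
  show ?thesis
    using that[OF \<epsilon> \<tau>\<^sub>0(1)] near0 near trans inj unfolding z\<^sub>0_def by blast
qed

lemma orbit_snd_strict_decreasing:
  assumes st: "s < t" and range: "\<And>u. u \<in> {s..t} \<Longrightarrow> fst (orbit lam e u) \<in> {- lam<..<0}"
  shows "snd (orbit lam e t) < snd (orbit lam e s)"
proof (rule DERIV_neg_imp_decreasing[OF st], intro exI conjI)
  fix u assume "s \<le> u" "u \<le> t"
  then have u: "fst (orbit lam e u) \<in> {- lam<..<0}" by (intro range) auto
  then have "fst (newton_flow (2 * lam) lam u (- e, 0)) \<in> {- (2 * lam)..0}" by (auto simp: orbit_def)
  from newton_flow_deriv_snd[OF two_lam this]
  show "((\<lambda>u. snd (orbit lam e u)) has_real_derivative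
      fst (orbit lam e u) * (fst (orbit lam e u) + lam)) (at u)"
    by (simp add: orbit_def)
  show "fst (orbit lam e u) * (fst (orbit lam e u) + lam) < 0"
    using u by (intro mult_neg_pos) auto
qed

lemma kick_energy_drop:
  assumes \<tau>: "0 \<le> \<tau>" and range: "\<And>s. s \<in> {0..\<tau>} \<Longrightarrow> fst (kick s z) \<in> {- (2 * lam)..0}"
    and j: "\<And>s. s \<in> {0..\<tau>} \<Longrightarrow> j \<le> half_square_rate (kick s z)"
  shows "energy lam (kick \<tau> z) \<le> energy lam z - 2 * (lam - mu) * j * \<tau>"
proof -
  have "(fst (kick 0 z))\<^sup>2 - 2 * j * 0 \<le> (fst (kick \<tau> z))\<^sup>2 - 2 * j * \<tau>"
  proof (rule DERIV_nonneg_imp_nondecreasing[OF \<tau>], intro exI conjI)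
    fix s assume "0 \<le> s" "s \<le> \<tau>"
    show "((\<lambda>s. (fst (kick s z))\<^sup>2 - 2 * j * s) has_real_derivative 2 * half_square_rate (kick s z) - 2 * j) (at s)"
      by (auto intro!: derivative_eq_intros newton_flow_deriv_fst[OF two_lam] simp: half_square_rate_def)
    show "0 \<le> 2 * half_square_rate (kick s z) - 2 * j" using j[of s] \<open>0 \<le> s\<close> \<open>s \<le> \<tau>\<close> by simp
  qed
  then have "(lam - mu) * (2 * j * \<tau>) \<le> (lam - mu) * ((fst (kick \<tau> z))\<^sup>2 - (fst z)\<^sup>2)"
    using mu by (intro mult_left_mono) (auto simp: newton_flow_0[OF two_lam])
  then show ?thesis using kick_energy[OF \<tau> range] by (simp add: mult.commute mult.left_commute)
qed

lemma kick_energy_rise: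
  assumes \<tau>: "0 \<le> \<tau>" and range: "\<And>s. s \<in> {0..\<tau>} \<Longrightarrow> fst (kick s z) \<in> {- (2 * lam)..0}"
    and j: "\<And>s. s \<in> {0..\<tau>} \<Longrightarrow> half_square_rate (kick s z) \<le> - j"
  shows "energy lam z + 2 * (lam - mu) * j * \<tau> \<le> energy lam (kick \<tau> z)"
proof -
  have "(fst (kick 0 z))\<^sup>2 + 2 * j * 0 \<ge> (fst (kick \<tau> z))\<^sup>2 + 2 * j * \<tau>"
  proof (rule DERIV_nonpos_imp_nonincreasing[OF \<tau>], intro exI conjI)
    fix s assume "0 \<le> s" "s \<le> \<tau>"
    show "((\<lambda>s. (fst (kick s z))\<^sup>2 + 2 * j * s) has_real_derivative 2 * half_square_rate (kick s z) + 2 * j) (at s)"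
      by (auto intro!: derivative_eq_intros newton_flow_deriv_fst[OF two_lam] simp: half_square_rate_def)
    show "2 * half_square_rate (kick s z) + 2 * j \<le> 0" using j[of s] \<open>0 \<le> s\<close> \<open>s \<le> \<tau>\<close> by simp
  qed
  then have "(lam - mu) * ((fst (kick \<tau> z))\<^sup>2 - (fst z)\<^sup>2) \<le> (lam - mu) * (- (2 * j * \<tau>))"
    using mu by (intro mult_left_mono) (auto simp: newton_flow_0[OF two_lam])
  then show ?thesis using kick_energy[OF \<tau> range] by (simp add: mult.commute mult.left_commute)
qed

definition kicked_level :: "real \<Rightarrow> real \<Rightarrow> real \<Rightarrow> real" where
  "kicked_level \<tau> e t = energy lam (kick \<tau> (orbit lam e t))"

text \<open>All that the coding argument has to know about the second phase. For the levels \<open>[a, b]\<close> and the times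
\<open>[- \<delta>, \<delta>]\<close> around the inner turning point: the motion stays in \<open>x < 0\<close>; the energy after the kick
strictly decreases in the time \<open>t\<close> at which the kick sets in; its range covers all levels between \<open>b\<close> and \<open>a\<close>; and
if \<open>t\<close> leads from level \<open>e\<close> to \<open>e'\<close> while \<open>t'\<close> leads from \<open>e'\<close> back to \<open>e\<close>, then the point with time
\<open>t\<close> on level \<open>e\<close> lands on level \<open>e'\<close> at the time \<open>- t'\<close>.\<close>

definition kick_window :: "real \<Rightarrow> real \<Rightarrow> real \<Rightarrow> real \<Rightarrow> bool" where
  "kick_window a b \<delta> \<tau> \<longleftrightarrow>
    (\<forall>e\<in>{a..b}. \<forall>t\<in>{-\<delta>..\<delta>}. \<forall>s\<in>{0..\<tau>}. fst (kick s (orbit lam e t)) \<in> {- (2 * lam)..<0}) \<and>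
    (\<forall>e\<in>{a..b}. \<forall>s\<in>{-\<delta>..\<delta>}. \<forall>t\<in>{-\<delta>..\<delta>}. s < t \<longrightarrow> kicked_level \<tau> e t < kicked_level \<tau> e s) \<and>
    (\<forall>e\<in>{a..b}. level lam a \<le> kicked_level \<tau> e (- \<delta>) \<and> kicked_level \<tau> e \<delta> \<le> level lam b) \<and>
    (\<forall>e\<in>{a..b}. \<forall>e'\<in>{a..b}. \<forall>t\<in>{-\<delta>..\<delta>}. \<forall>t'\<in>{-\<delta>..\<delta>}.
      kicked_level \<tau> e t = level lam e' \<longrightarrow> kicked_level \<tau> e' t' = level lam e \<longrightarrow>
      kick \<tau> (orbit lam e t) = orbit lam e' (- t'))"

text \<open>The last property of the window comes from reversibility. Let \<open>y\<close> be the point of level \<open>e'\<close> with time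
\<open>t'\<close> and let \<open>w\<close> be the reflection of its image. Then \<open>w\<close> lies on level \<open>e\<close>, and the kick sends it to
the reflection of \<open>y\<close>, on level \<open>e'\<close>. By transversality only one point has these two levels, so \<open>w\<close> is the
point of level \<open>e\<close> with time \<open>t\<close>.

The choices depend on each other in this order: the discs, then \<open>\<delta>\<close>, then the bound on \<open>\<tau>\<close>, and finally
\<open>b\<close>, so close to \<open>a\<close> that the energy gained or lost by the shortest admissible kick at \<open>\<plusminus> \<delta>\<close> bridges the
gap between the two levels.\<close>

lemma kick_window_exists:
  obtains a b \<delta> \<tau>\<^sub>l \<tau>\<^sub>h where "0 < a" "a < b" "b < lam / 2" "0 < \<delta>" "4 * \<delta> < period lam b"
    "0 < \<tau>\<^sub>l" "\<tau>\<^sub>l < \<tau>\<^sub>h" "\<And>\<tau>. \<tau> \<in> {\<tau>\<^sub>l<..<\<tau>\<^sub>h} \<Longrightarrow> kick_window a b \<delta> \<tau>"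
proof -
  define z\<^sub>0 :: "real \<times> real" where "z\<^sub>0 = (- (lam / 4), 0)"
  define a where "a = lam / 4"
  have a: "0 < a" "a < lam / 2" using lam by (auto simp: a_def)
  obtain \<epsilon> \<tau>\<^sub>0 where \<epsilon>: "0 < \<epsilon>" "\<epsilon> \<le> lam / 16" and \<tau>\<^sub>0: "0 < \<tau>\<^sub>0"
    and near0: "\<And>z t. z \<in> cball z\<^sub>0 (\<epsilon> / 16) \<Longrightarrow> t \<in> {0..\<tau>\<^sub>0} \<Longrightarrow> kick t z \<in> cball z\<^sub>0 (\<epsilon> / 4)"
    and near: "\<And>z t. z \<in> cball z\<^sub>0 (\<epsilon> / 4) \<Longrightarrow> t \<in> {0..\<tau>\<^sub>0} \<Longrightarrow> kick t z \<in> cball z\<^sub>0 \<epsilon>"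
    and trans: "\<And>z w \<tau>. \<lbrakk>z \<in> cball z\<^sub>0 (\<epsilon> / 4); w \<in> cball z\<^sub>0 (\<epsilon> / 4);
        energy lam z = energy lam w; 0 < \<tau>; \<tau> \<le> \<tau>\<^sub>0; snd z < snd w\<rbrakk>
      \<Longrightarrow> energy lam (kick \<tau> z) < energy lam (kick \<tau> w)"
    and inj: "\<And>z w. \<lbrakk>z \<in> cball z\<^sub>0 (\<epsilon> / 4); w \<in> cball z\<^sub>0 (\<epsilon> / 4);
        energy lam z = energy lam w; snd z = snd w\<rbrakk> \<Longrightarrow> z = w"
    unfolding z\<^sub>0_def by (rule transversality) blast
  have orbit0: "orbit lam a 0 = z\<^sub>0"
    by (simp add: orbit_def newton_flow_0[OF two_lam] a_def z\<^sub>0_def)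
  have "continuous_on UNIV (\<lambda>p. orbit lam (fst p) (snd p))"
    by (intro continuous_on_orbit[OF lam] continuous_intros)
  from continuous_near[OF this, of "ball z\<^sub>0 (\<epsilon> / 16)" "(a, 0)"] \<epsilon>
  obtain d where d: "d > 0" "\<And>p. dist p (a, 0) < d \<Longrightarrow> orbit lam (fst p) (snd p) \<in> ball z\<^sub>0 (\<epsilon> / 16)"
    by (auto simp: orbit0)
  have close: "orbit lam e t \<in> cball z\<^sub>0 (\<epsilon> / 16)" if "\<bar>e - a\<bar> < d / 2" "\<bar>t\<bar> < d / 2" for e t
  proof -
    have "dist (e, t) (a, 0) < d"
      using norm_Pair_le[of "e - a" t] that by (simp add: dist_norm)
    from d(2)[OF this] show ?thesis by auto
  qed
  define \<delta> where "\<delta> = min (d / 4) (period lam (3 / 8 * lam) / 8)"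
  have per: "0 < period lam (3 / 8 * lam)" using lam by (intro period_pos) auto
  have \<delta>: "0 < \<delta>" "\<delta> < d / 2" "4 * \<delta> < period lam (3 / 8 * lam)"
    using d(1) per by (auto simp: \<delta>_def)
  have ball_range: "fst p \<in> {- lam<..<0}" if "p \<in> cball z\<^sub>0 \<epsilon>" for p
    using mem_cball_pair[of p "- (lam / 4)" 0 \<epsilon>] that \<epsilon> lam by (auto simp: z\<^sub>0_def)
  have sub: "p \<in> cball z\<^sub>0 (\<epsilon> / 4)" "p \<in> cball z\<^sub>0 \<epsilon>" if "p \<in> cball z\<^sub>0 (\<epsilon> / 16)" for p
    using that \<epsilon> by auto
  have snd_decr: "snd (orbit lam e t) < snd (orbit lam e s)"
    if "\<bar>e - a\<bar> < d / 2" "s \<in> {-\<delta>..\<delta>}" "t \<in> {-\<delta>..\<delta>}" "s < t" for e s t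
    using that \<delta> by (intro orbit_snd_strict_decreasing ball_range sub(2) close) auto
  define j where "j = half_square_rate (orbit lam a \<delta>) / 2"
  have j: "0 < j"
  proof -
    have "snd (orbit lam a \<delta>) < snd (orbit lam a 0)"
      using d(1) \<delta> by (intro snd_decr) auto
    then have "snd (orbit lam a \<delta>) < 0" by (simp add: orbit0 z\<^sub>0_def)
    moreover have "fst (orbit lam a \<delta>) < 0"
      using ball_range[OF sub(2)[OF close[of a \<delta>]]] d(1) \<delta> by auto
    ultimately show ?thesis by (simp add: j_def half_square_rate_def mult_neg_neg)
  qed
  have "continuous_on UNIV (\<lambda>p. half_square_rate (kick (snd p) (orbit lam (fst p) \<delta>)))"
    unfolding half_square_rate_def
    by (intro continuous_intros continuous_on_newton_flow[OF two_lam] continuous_on_orbit[OF lam])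
  from continuous_near[OF this, of "{j<..}" "(a, 0)"] j
  obtain d1 where d1: "d1 > 0"
    "\<And>p. dist p (a, 0) < d1 \<Longrightarrow> j < half_square_rate (kick (snd p) (orbit lam (fst p) \<delta>))"
    by (auto simp: newton_flow_0[OF two_lam] j_def)
  have "continuous_on UNIV (\<lambda>p. half_square_rate (kick (snd p) (orbit lam (fst p) (- \<delta>))))"
    unfolding half_square_rate_def
    by (intro continuous_intros continuous_on_newton_flow[OF two_lam] continuous_on_orbit[OF lam])
  moreover have "half_square_rate (orbit lam a (- \<delta>)) = - half_square_rate (orbit lam a \<delta>)"
    unfolding orbit_reflect[OF a, symmetric] by (simp add: half_square_rate_def reflect_def)
  ultimately obtain d2 where d2: "d2 > 0"
    "\<And>p. dist p (a, 0) < d2 \<Longrightarrow> half_square_rate (kick (snd p) (orbit lam (fst p) (- \<delta>))) < - j"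
    using continuous_near[of "\<lambda>p. half_square_rate (kick (snd p) (orbit lam (fst p) (- \<delta>)))" "{..<- j}" "(a, 0)"] j
    by (auto simp: newton_flow_0[OF two_lam] j_def)
  define d3 where "d3 = min (min d1 d2) d / 2"
  have d3: "0 < d3" "d3 \<le> d / 2" using d d1 d2 by (auto simp: d3_def)
  have rate: "j \<le> half_square_rate (kick s (orbit lam e \<delta>))" "half_square_rate (kick s (orbit lam e (- \<delta>))) \<le> - j"
    if "\<bar>e - a\<bar> < d3" "\<bar>s\<bar> < d3" for e s
  proof -
    have "dist (e, s) (a, 0) < d1" "dist (e, s) (a, 0) < d2"
      using norm_Pair_le[of "e - a" s] that by (auto simp: dist_norm d3_def)
    from d1(2)[OF this(1)] d2(2)[OF this(2)]
    show "j \<le> half_square_rate (kick s (orbit lam e \<delta>))" "half_square_rate (kick s (orbit lam e (- \<delta>))) \<le> - j"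
      by auto
  qed
  define \<tau>\<^sub>h where "\<tau>\<^sub>h = min \<tau>\<^sub>0 d3"
  define \<tau>\<^sub>l where "\<tau>\<^sub>l = \<tau>\<^sub>h / 2"
  have \<tau>\<^sub>h: "0 < \<tau>\<^sub>l" "\<tau>\<^sub>l < \<tau>\<^sub>h" "\<tau>\<^sub>h \<le> \<tau>\<^sub>0" "\<tau>\<^sub>h \<le> d3" using \<tau>\<^sub>0 d3 by (auto simp: \<tau>\<^sub>h_def \<tau>\<^sub>l_def)
  define gain where "gain = 2 * (lam - mu) * j * \<tau>\<^sub>l"
  have gain: "0 < gain" using mu j \<tau>\<^sub>h by (simp add: gain_def)
  have "continuous_on UNIV (level lam)"
    unfolding level_def[abs_def] energy_def by (intro continuous_intros)
  from continuous_near[OF this, of "{level lam a - gain<..}" a] gain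
  obtain d4 where d4: "d4 > 0" "\<And>e. dist e a < d4 \<Longrightarrow> level lam a - gain < level lam e" by auto
  \<comment> \<open>\<open>b < 3 \<lambda> / 8\<close> bounds the period on \<open>b\<close> from below by the one that entered the choice of \<open>\<delta>\<close>.\<close>
  define b where "b = a + min (min d3 d4) (lam / 8) / 2"
  have b: "a < b" "b < a + d3" "b < a + d4" "b < 3 / 8 * lam"
    using d3 d4 lam by (auto simp: b_def a_def)
  have gap: "level lam a - level lam b \<le> gain"
    using d4(2)[of b] b by (simp add: dist_real_def)
  have level_between: "level lam b \<le> level lam e" "level lam e \<le> level lam a" if "e \<in> {a..b}" for e
    using level_strict_antimono[of e b lam] level_strict_antimono[of a e lam] that a b lam
    by (cases "e = a"; cases "e = b"; auto)+
  have "4 * \<delta> < period lam b"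
    using period_strict_antimono[of b "3 / 8 * lam" lam] \<delta>(3) a b lam by auto
  moreover have "kick_window a b \<delta> \<tau>" if "\<tau> \<in> {\<tau>\<^sub>l<..<\<tau>\<^sub>h}" for \<tau>
  proof -
    have \<tau>: "0 < \<tau>" "\<tau> \<le> \<tau>\<^sub>0" "\<tau>\<^sub>l < \<tau>" "\<tau> < d3" using that \<tau>\<^sub>h by auto
    have e: "0 < e" "e < lam / 2" "\<bar>e - a\<bar> < d / 2" "\<bar>e - a\<bar> < d3" if "e \<in> {a..b}" for e
      using that a b d3 lam by auto
    have near_orbit: "orbit lam e t \<in> cball z\<^sub>0 (\<epsilon> / 16)" if "e \<in> {a..b}" "t \<in> {-\<delta>..\<delta>}" for e t
      using e(3)[OF that(1)] that \<delta> by (intro close) auto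
    have kick_range: "fst (kick s (orbit lam e t)) \<in> {- lam<..<0}"
      if "e \<in> {a..b}" "t \<in> {-\<delta>..\<delta>}" "s \<in> {0..\<tau>}" for e t s
      using that \<tau> by (intro ball_range near sub(1) near_orbit) auto
    have "fst (kick s (orbit lam e t)) \<in> {- (2 * lam)..<0}"
      if "e \<in> {a..b}" "t \<in> {-\<delta>..\<delta>}" "s \<in> {0..\<tau>}" for e t s
      using kick_range[OF that] lam by auto
    moreover have "kicked_level \<tau> e t < kicked_level \<tau> e s"
      if "e \<in> {a..b}" "s \<in> {-\<delta>..\<delta>}" "t \<in> {-\<delta>..\<delta>}" "s < t" for e s t
      unfolding kicked_level_def
      using that e[OF that(1)] \<tau> by (intro trans sub(1) near_orbit snd_decr) (auto simp: orbit_energy)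
    moreover have "level lam a \<le> kicked_level \<tau> e (- \<delta>)" "kicked_level \<tau> e \<delta> \<le> level lam b"
      if he: "e \<in> {a..b}" for e
    proof -
      have r: "fst (kick s (orbit lam e t)) \<in> {- (2 * lam)..0}" if "t \<in> {-\<delta>..\<delta>}" "s \<in> {0..\<tau>}" for t s
        using kick_range[OF he that] lam by auto
      have g: "gain \<le> 2 * (lam - mu) * j * \<tau>"
        unfolding gain_def using mu j \<tau> by (intro mult_left_mono) auto
      have "energy lam (orbit lam e (- \<delta>)) + 2 * (lam - mu) * j * \<tau> \<le> kicked_level \<tau> e (- \<delta>)"
        unfolding kicked_level_def
        using \<tau> \<delta> e(4)[OF he] by (intro kick_energy_rise r rate) auto
      then show "level lam a \<le> kicked_level \<tau> e (- \<delta>)"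
        using orbit_energy[OF e(1,2)[OF he]] g gap level_between[OF he] by simp
      have "kicked_level \<tau> e \<delta> \<le> energy lam (orbit lam e \<delta>) - 2 * (lam - mu) * j * \<tau>"
        unfolding kicked_level_def
        using \<tau> \<delta> e(4)[OF he] by (intro kick_energy_drop r rate) auto
      then show "kicked_level \<tau> e \<delta> \<le> level lam b"
        using orbit_energy[OF e(1,2)[OF he]] g gap level_between[OF he] by simp
    qed
    moreover have "kick \<tau> (orbit lam e t) = orbit lam e' (- t')"
      if he: "e \<in> {a..b}" "e' \<in> {a..b}" and ht: "t \<in> {-\<delta>..\<delta>}" "t' \<in> {-\<delta>..\<delta>}"
        and 1: "kicked_level \<tau> e t = level lam e'" and 2: "kicked_level \<tau> e' t' = level lam e" for e e' t t'
    proof -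
      define y where "y = orbit lam e' t'"
      define w where "w = reflect (kick \<tau> y)"
      have y: "y \<in> cball z\<^sub>0 (\<epsilon> / 16)" unfolding y_def by (rule near_orbit[OF he(2) ht(2)])
      have en_reflect: "energy lam (reflect p) = energy lam p" for p
        by (simp add: energy_def reflect_def)
      have w: "w \<in> cball z\<^sub>0 (\<epsilon> / 4)"
      proof -
        have "dist z\<^sub>0 (reflect p) = dist z\<^sub>0 p" for p
          by (simp add: z\<^sub>0_def reflect_def dist_prod_def dist_real_def)
        then show ?thesis unfolding w_def using near0[OF y, of \<tau>] \<tau> by simp
      qed
      have kw: "kick \<tau> w = orbit lam e' (- t')"
        unfolding w_def newton_flow_reflect_inverse[OF two_lam] y_def
        by (rule orbit_reflect[OF e(1,2)[OF he(2)]])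
      have z: "orbit lam e t \<in> cball z\<^sub>0 (\<epsilon> / 4)" by (rule sub(1)[OF near_orbit[OF he(1) ht(1)]])
      have same: "energy lam (orbit lam e t) = energy lam w"
        unfolding w_def en_reflect orbit_energy[OF e(1,2)[OF he(1)]]
        using 2 by (simp add: kicked_level_def y_def)
      have same': "energy lam (kick \<tau> (orbit lam e t)) = energy lam (kick \<tau> w)"
        unfolding kw orbit_energy[OF e(1,2)[OF he(2)]] using 1 by (simp add: kicked_level_def)
      have "snd (orbit lam e t) = snd w"
        using trans[OF z w same \<tau>(1,2)] trans[OF w z same[symmetric] \<tau>(1,2)] same'
        by (cases "snd (orbit lam e t)" "snd w" rule: linorder_cases) auto
      from inj[OF z w same this] show ?thesis by (simp add: kw)
    qed
    ultimately show ?thesis unfolding kick_window_def by blast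
  qed
  moreover have "b < lam / 2" using b lam by simp
  ultimately show ?thesis using that a(1) b(1) \<delta>(1) \<tau>\<^sub>h(1,2) by blast
qed

end

section \<open>Solutions of the switched system\<close>

text \<open>Uniqueness for solutions in the integral sense, where the right-hand side may jump in time. At a
maximum of the difference weighted by \<open>exp (- 2 L t)\<close> the integral equation bounds the maximum by half of
itself.\<close>

lemma integral_equation_unique:
  fixes z w :: "real \<Rightarrow> 'a::euclidean_space"
  assumes cont: "continuous_on {0..T} z" "continuous_on {0..T} w"
    and z: "\<And>t. t \<in> {0..T} \<Longrightarrow> ((\<lambda>s. f s (z s)) has_integral (z t - z\<^sub>0)) {0..t}"
    and w: "\<And>t. t \<in> {0..T} \<Longrightarrow> ((\<lambda>s. f s (w s)) has_integral (w t - z\<^sub>0)) {0..t}"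
    and lip: "\<And>s. s \<in> {0..T} \<Longrightarrow> norm (f s (z s) - f s (w s)) \<le> L * norm (z s - w s)"
    and L: "L > 0" and t: "t \<in> {0..T}"
  shows "z t = w t"
proof -
  define u where "u s = norm (z s - w s) * exp (- 2 * L * s)" for s
  have "continuous_on {0..T} u"
    unfolding u_def by (intro continuous_intros cont)
  then obtain m where m: "m \<in> {0..T}" "\<And>s. s \<in> {0..T} \<Longrightarrow> u s \<le> u m"
    using continuous_attains_sup[of "{0..T}" u] t by auto
  have "norm (z m - w m) \<le> u m * exp (2 * L * m) / 2"
  proof -
    have *: "((\<lambda>s. f s (z s) - f s (w s)) has_integral ((z m - z\<^sub>0) - (w m - z\<^sub>0))) {0..m}"
      by (intro has_integral_diff z w m(1))
    have **: "((\<lambda>s. u m * exp (2 * L * s) * L) has_integral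
        (u m * exp (2 * L * m) / 2 - u m * exp (2 * L * 0) / 2)) {0..m}"
      using m(1) by (intro fundamental_theorem_of_calculus)
        (auto intro!: derivative_eq_intros simp flip: has_real_derivative_iff_has_vector_derivative)
    have "norm (f s (z s) - f s (w s)) \<le> u m * exp (2 * L * s) * L" if "s \<in> {0..m}" for s
    proof -
      have "norm (z s - w s) = u s * exp (2 * L * s)"
        by (simp add: u_def exp_minus)
      also have "\<dots> \<le> u m * exp (2 * L * s)"
        using m that by (intro mult_right_mono) auto
      finally have "L * norm (z s - w s) \<le> L * (u m * exp (2 * L * s))"
        using L by (intro mult_left_mono) auto
      then show ?thesis using lip[of s] m(1) that by (simp add: mult.commute)
    qed
    then have "norm (integral {0..m} (\<lambda>s. f s (z s) - f s (w s)))
        \<le> integral {0..m} (\<lambda>s. u m * exp (2 * L * s) * L)"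
      using * ** by (intro integral_norm_bound_integral has_integral_integrable) blast+
    then have "norm (z m - w m) \<le> u m * exp (2 * L * m) / 2 - u m / 2"
      using integral_unique[OF *] integral_unique[OF **] by simp
    moreover have "0 \<le> u m" by (simp add: u_def)
    ultimately show ?thesis by simp
  qed
  then have "u m \<le> u m * exp (2 * L * m) / 2 * exp (- 2 * L * m)"
    unfolding u_def[of m, symmetric] by (metis (no_types) u_def exp_ge_zero mult_right_mono)
  then have "u m \<le> u m / 2 * (exp (2 * L * m) * exp (- 2 * L * m))" by simp
  then have "u m \<le> u m / 2" by (simp flip: exp_add)
  then have "u t \<le> 0" using m(2)[OF t] by simp
  then show ?thesis by (simp add: u_def mult_le_0_iff)
qed

text \<open>The forcing cancels in the difference, so the Lipschitz constant on a ball is the same in both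
phases.\<close>

lemma planar_field_lipschitz:
  assumes "norm z \<le> M" "norm w \<le> M"
  shows "norm (planar_field q z - planar_field q w) \<le> (4 * M + 1) * norm (z - w)"
proof -
  obtain x y where z: "z = (x, y)" by (cases z)
  obtain x' y' where w: "w = (x', y')" by (cases w)
  have xy: "\<bar>x\<bar> \<le> M" "\<bar>y\<bar> \<le> M" "\<bar>y'\<bar> \<le> M"
    using assms norm_fst_le[of x y] norm_snd_le[of y x] norm_snd_le[of y' x'] by (auto simp: z w)
  have n: "\<bar>x - x'\<bar> \<le> norm (z - w)" "\<bar>y - y'\<bar> \<le> norm (z - w)"
    using norm_fst_le[of "x - x'" "y - y'"] norm_snd_le[of "y - y'" "x - x'"] by (auto simp: z w)
  have "\<bar>x * y - x' * y'\<bar> = \<bar>x * (y - y') + y' * (x - x')\<bar>" by (simp add: algebra_simps)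
  also have "\<dots> \<le> \<bar>x\<bar> * \<bar>y - y'\<bar> + \<bar>y'\<bar> * \<bar>x - x'\<bar>"
    unfolding abs_mult[symmetric] by (rule abs_triangle_ineq)
  also have "\<dots> \<le> M * norm (z - w) + M * norm (z - w)"
    using xy n by (intro add_mono mult_mono) auto
  finally have 1: "\<bar>x * y - x' * y'\<bar> \<le> 2 * M * norm (z - w)" by simp
  have "\<bar>y\<^sup>2 - y'\<^sup>2\<bar> = \<bar>y + y'\<bar> * \<bar>y - y'\<bar>"
    by (simp add: abs_mult[symmetric] power2_eq_square algebra_simps)
  also have "\<dots> \<le> (2 * M) * norm (z - w)" using xy n by (intro mult_mono) auto
  finally have 2: "\<bar>(x - y\<^sup>2) - (x' - y'\<^sup>2)\<bar> \<le> norm (z - w) + 2 * M * norm (z - w)" using n by simp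
  have "norm (planar_field q z - planar_field q w) \<le> \<bar>x * y - x' * y'\<bar> + \<bar>(x - y\<^sup>2) - (x' - y'\<^sup>2)\<bar>"
    using norm_Pair_le[of "x * y - x' * y'" "(x - y\<^sup>2) - (x' - y'\<^sup>2)"] by (simp add: planar_field_def z w algebra_simps)
  then show ?thesis using 1 2 by (simp add: distrib_right)
qed

lemma solves_ivp_unique:
  assumes z: "solves_ivp p T z\<^sub>0 z" and w: "solves_ivp p T z\<^sub>0 w" and t: "t \<in> {0..T}"
  shows "z t = w t"
proof -
  have cont: "continuous_on {0..T} z" "continuous_on {0..T} w" using z w by (auto simp: solves_ivp_def)
  have "bounded (z ` {0..T} \<union> w ` {0..T})"
    using cont by (intro bounded_Un[THEN iffD2] conjI compact_imp_bounded compact_continuous_image) auto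
  then obtain M where M: "M > 0" "\<And>u. u \<in> z ` {0..T} \<union> w ` {0..T} \<Longrightarrow> norm u \<le> M"
    unfolding bounded_pos by blast
  show ?thesis
  proof (rule integral_equation_unique[OF cont, where f = "\<lambda>s. planar_field (p s)" and L = "4 * M + 1" and z\<^sub>0 = z\<^sub>0])
    show "norm (planar_field (p s) (z s) - planar_field (p s) (w s)) \<le> (4 * M + 1) * norm (z s - w s)"
      if "s \<in> {0..T}" for s
      using that by (intro planar_field_lipschitz M) auto
  qed (use z w t M in \<open>auto simp: solves_ivp_def\<close>)
qed

lemma poincare_map_eq:
  assumes "solves_ivp p T z\<^sub>0 z" "0 \<le> T"
  shows "poincare_map p T z\<^sub>0 = Some (z T)"
proof -
  have "(THE w. \<exists>z. solves_ivp p T z\<^sub>0 z \<and> z T = w) = z T"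
  proof (rule the_equality)
    fix w assume "\<exists>z. solves_ivp p T z\<^sub>0 z \<and> z T = w"
    then obtain z' where "solves_ivp p T z\<^sub>0 z'" "z' T = w" by blast
    then show "w = z T" using solves_ivp_unique[OF _ assms(1), of z' T] assms(2) by simp
  qed (use assms in blast)
  then show ?thesis using assms by (auto simp: poincare_map_def)
qed

lemma switched_forcing_eq:
  assumes "0 < \<tau>\<^sub>1" "0 < \<tau>\<^sub>2"
  shows "0 \<le> t \<Longrightarrow> t < \<tau>\<^sub>1 \<Longrightarrow> switched_forcing l\<^sub>1 l\<^sub>2 \<tau>\<^sub>1 \<tau>\<^sub>2 t = l\<^sub>1"
    and "\<tau>\<^sub>1 \<le> t \<Longrightarrow> t < \<tau>\<^sub>1 + \<tau>\<^sub>2 \<Longrightarrow> switched_forcing l\<^sub>1 l\<^sub>2 \<tau>\<^sub>1 \<tau>\<^sub>2 t = l\<^sub>2"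
proof -
  have "\<lfloor>t / (\<tau>\<^sub>1 + \<tau>\<^sub>2)\<rfloor> = 0" if "0 \<le> t" "t < \<tau>\<^sub>1 + \<tau>\<^sub>2"
    using that by (simp add: floor_eq_iff)
  then show "0 \<le> t \<Longrightarrow> t < \<tau>\<^sub>1 \<Longrightarrow> switched_forcing l\<^sub>1 l\<^sub>2 \<tau>\<^sub>1 \<tau>\<^sub>2 t = l\<^sub>1"
    "\<tau>\<^sub>1 \<le> t \<Longrightarrow> t < \<tau>\<^sub>1 + \<tau>\<^sub>2 \<Longrightarrow> switched_forcing l\<^sub>1 l\<^sub>2 \<tau>\<^sub>1 \<tau>\<^sub>2 t = l\<^sub>2"
    using assms by (auto simp: switched_forcing_def)
qed

text \<open>The forcing at the switching time and at the end of the period belongs to the next phase. These are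
single points, which the integrals ignore.\<close>

lemma solves_ivp_switched:
  assumes \<tau>: "0 < \<tau>\<^sub>1" "0 < \<tau>\<^sub>2"
    and c1: "\<And>t. t \<in> {0..\<tau>\<^sub>1} \<Longrightarrow> (c\<^sub>1 has_vector_derivative planar_field l\<^sub>1 (c\<^sub>1 t)) (at t)"
    and c2: "\<And>t. t \<in> {0..\<tau>\<^sub>2} \<Longrightarrow> (c\<^sub>2 has_vector_derivative planar_field l\<^sub>2 (c\<^sub>2 t)) (at t)"
    and glue: "c\<^sub>2 0 = c\<^sub>1 \<tau>\<^sub>1"
  shows "solves_ivp (switched_forcing l\<^sub>1 l\<^sub>2 \<tau>\<^sub>1 \<tau>\<^sub>2) (\<tau>\<^sub>1 + \<tau>\<^sub>2) (c\<^sub>1 0)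
    (\<lambda>t. if t \<le> \<tau>\<^sub>1 then c\<^sub>1 t else c\<^sub>2 (t - \<tau>\<^sub>1))"
proof -
  let ?Z = "\<lambda>t. if t \<le> \<tau>\<^sub>1 then c\<^sub>1 t else c\<^sub>2 (t - \<tau>\<^sub>1)" and ?p = "switched_forcing l\<^sub>1 l\<^sub>2 \<tau>\<^sub>1 \<tau>\<^sub>2"
  let ?T = "\<tau>\<^sub>1 + \<tau>\<^sub>2"
  have c2': "((\<lambda>t. c\<^sub>2 (t - \<tau>\<^sub>1)) has_vector_derivative planar_field l\<^sub>2 (c\<^sub>2 (t - \<tau>\<^sub>1))) (at t)"
    if "t \<in> {\<tau>\<^sub>1..?T}" for t
  proof -
    have "((\<lambda>t. t - \<tau>\<^sub>1) has_vector_derivative 1) (at t)"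
      by (auto intro!: derivative_eq_intros)
    from vector_diff_chain_at[OF this c2] that show ?thesis by (auto simp: o_def)
  qed
  have cont1: "continuous_on {0..\<tau>\<^sub>1} c\<^sub>1"
    using c1 by (intro continuous_on_vector_derivative) (rule has_vector_derivative_at_within)
  have cont2: "continuous_on {\<tau>\<^sub>1..?T} (\<lambda>t. c\<^sub>2 (t - \<tau>\<^sub>1))"
    using c2' by (intro continuous_on_vector_derivative) (rule has_vector_derivative_at_within)
  have "continuous_on ({0..\<tau>\<^sub>1} \<union> {\<tau>\<^sub>1..?T}) ?Z"
    using glue by (intro continuous_on_If cont1 cont2) auto
  moreover have "{0..\<tau>\<^sub>1} \<union> {\<tau>\<^sub>1..?T} = {0..?T}" using \<tau> by auto
  ultimately have cont: "continuous_on {0..?T} ?Z" by simp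
  have int1: "((\<lambda>s. planar_field (?p s) (?Z s)) has_integral (c\<^sub>1 t - c\<^sub>1 0)) {0..t}" if "t \<in> {0..\<tau>\<^sub>1}" for t
  proof (rule has_integral_spike_finite[where S = "{\<tau>\<^sub>1}"])
    show "((\<lambda>s. planar_field l\<^sub>1 (c\<^sub>1 s)) has_integral (c\<^sub>1 t - c\<^sub>1 0)) {0..t}"
      using that by (intro fundamental_theorem_of_calculus has_vector_derivative_at_within[OF c1]) auto
    show "planar_field (?p s) (?Z s) = planar_field l\<^sub>1 (c\<^sub>1 s)" if "s \<in> {0..t} - {\<tau>\<^sub>1}" for s
      using that \<open>t \<in> {0..\<tau>\<^sub>1}\<close> switched_forcing_eq(1)[OF \<tau>, of s] by auto
  qed simp
  have int2: "((\<lambda>s. planar_field (?p s) (?Z s)) has_integral (c\<^sub>2 (t - \<tau>\<^sub>1) - c\<^sub>1 \<tau>\<^sub>1)) {\<tau>\<^sub>1..t}"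
    if "t \<in> {\<tau>\<^sub>1..?T}" for t
  proof (rule has_integral_spike_finite[where S = "{?T}"])
    have "((\<lambda>s. planar_field l\<^sub>2 (c\<^sub>2 (s - \<tau>\<^sub>1))) has_integral (c\<^sub>2 (t - \<tau>\<^sub>1) - c\<^sub>2 (\<tau>\<^sub>1 - \<tau>\<^sub>1))) {\<tau>\<^sub>1..t}"
      using that by (intro fundamental_theorem_of_calculus has_vector_derivative_at_within[OF c2']) auto
    then show "((\<lambda>s. planar_field l\<^sub>2 (c\<^sub>2 (s - \<tau>\<^sub>1))) has_integral (c\<^sub>2 (t - \<tau>\<^sub>1) - c\<^sub>1 \<tau>\<^sub>1)) {\<tau>\<^sub>1..t}"
      by (simp add: glue)
    show "planar_field (?p s) (?Z s) = planar_field l\<^sub>2 (c\<^sub>2 (s - \<tau>\<^sub>1))" if "s \<in> {\<tau>\<^sub>1..t} - {?T}" for s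
      using that \<open>t \<in> {\<tau>\<^sub>1..?T}\<close> switched_forcing_eq(2)[OF \<tau>, of s] glue by auto
  qed simp
  have "((\<lambda>s. planar_field (?p s) (?Z s)) has_integral (?Z t - c\<^sub>1 0)) {0..t}" if "t \<in> {0..?T}" for t
  proof (cases "t \<le> \<tau>\<^sub>1")
    case True
    then show ?thesis using int1[of t] that by simp
  next
    case False
    have "((\<lambda>s. planar_field (?p s) (?Z s)) has_integral
        ((c\<^sub>1 \<tau>\<^sub>1 - c\<^sub>1 0) + (c\<^sub>2 (t - \<tau>\<^sub>1) - c\<^sub>1 \<tau>\<^sub>1))) {0..t}"
      using False \<tau> that by (intro has_integral_combine[OF _ _ int1 int2]) auto
    then show ?thesis using False by simp
  qed
  then show ?thesis using cont \<tau> by (simp add: solves_ivp_def)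
qed

definition to_planar :: "real \<times> real \<Rightarrow> real \<times> real" where
  "to_planar z = (fst z, snd z / fst z)"

lemma to_planar_inj: "to_planar z = to_planar w \<Longrightarrow> fst z \<noteq> 0 \<Longrightarrow> z = w"
  by (auto simp: to_planar_def prod_eq_iff)

lemma to_planar_deriv:
  assumes R: "R > 0" and range: "fst (newton_flow R q t z) \<in> {-R..<0}"
  shows "((\<lambda>t. to_planar (newton_flow R q t z)) has_vector_derivative
    planar_field q (to_planar (newton_flow R q t z))) (at t)"
proof -
  let ?x = "fst (newton_flow R q t z)" and ?v = "snd (newton_flow R q t z)"
  have x: "?x \<noteq> 0" and range': "?x \<in> {-R..0}" using range by auto
  have 1: "((\<lambda>t. fst (newton_flow R q t z)) has_real_derivative ?x * (?v / ?x)) (at t)"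
    using newton_flow_deriv_fst[OF R, of q z t] x by simp
  have 2: "((\<lambda>t. snd (newton_flow R q t z) / fst (newton_flow R q t z)) has_real_derivative
      ?x - (?v / ?x)\<^sup>2 + q) (at t)"
    using DERIV_divide[OF newton_flow_deriv_snd[OF R range'] newton_flow_deriv_fst[OF R, of q z t] x]
    by (rule DERIV_cong) (use x in \<open>simp add: field_simps power2_eq_square\<close>)
  show ?thesis
    using has_vector_derivative_Pair[OF 1[unfolded has_real_derivative_iff_has_vector_derivative]
        2[unfolded has_real_derivative_iff_has_vector_derivative]]
    by (simp add: to_planar_def planar_field_def)
qed

text \<open>In the coordinates \<open>(x, v)\<close> the Poincare map is a shift of time along an orbit of the first phase, followed
by the flow of the second.\<close>

lemma poincare_map_orbit:
  assumes e: "0 < e" "e < lam / 2" and \<tau>: "0 < \<tau>\<^sub>1" "0 < \<tau>\<^sub>2"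
    and kick: "\<And>s. s \<in> {0..\<tau>\<^sub>2} \<Longrightarrow> fst (newton_flow (2 * lam) mu s (orbit lam e (t + \<tau>\<^sub>1))) \<in> {- (2 * lam)..<0}"
  shows "poincare_map (switched_forcing lam mu \<tau>\<^sub>1 \<tau>\<^sub>2) (\<tau>\<^sub>1 + \<tau>\<^sub>2) (to_planar (orbit lam e t)) =
    Some (to_planar (newton_flow (2 * lam) mu \<tau>\<^sub>2 (orbit lam e (t + \<tau>\<^sub>1))))"
proof -
  have R: "2 * lam > 0" using e by simp
  let ?c1 = "\<lambda>s. to_planar (newton_flow (2 * lam) lam s (orbit lam e t))"
  let ?c2 = "\<lambda>s. to_planar (newton_flow (2 * lam) mu s (orbit lam e (t + \<tau>\<^sub>1)))"
  have "fst (orbit lam e (t + s)) \<in> {- (2 * lam)..<0}" for s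
    using orbit_range[OF e, of "t + s"] e by auto
  then have "solves_ivp (switched_forcing lam mu \<tau>\<^sub>1 \<tau>\<^sub>2) (\<tau>\<^sub>1 + \<tau>\<^sub>2) (?c1 0)
      (\<lambda>s. if s \<le> \<tau>\<^sub>1 then ?c1 s else ?c2 (s - \<tau>\<^sub>1))"
    by (intro solves_ivp_switched \<tau> to_planar_deriv R kick)
       (auto simp: orbit_add[OF e] newton_flow_0[OF R])
  from poincare_map_eq[OF this] show ?thesis
    using \<tau> by (simp add: newton_flow_0[OF R])
qed

section \<open>Monotone chains of equations\<close>

text \<open>The pointwise infimum \<open>M\<close> of all supersolutions is again a supersolution, because \<open>g\<close> decreases in the two
neighbours and is continuous in the middle variable. Were the inequality strict somewhere, that
one entry could be lowered without spoiling the inequalities at the neighbours. A shift that preserves the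
system permutes the supersolutions, so it preserves \<open>M\<close>: periodic data have a periodic solution
without any fixed point theorem for the period.\<close>

lemma monotone_chain_solution:
  fixes g :: "int \<Rightarrow> real \<Rightarrow> real \<Rightarrow> real \<Rightarrow> real" and a b :: real
  assumes ab: "a \<le> b"
    and cont: "\<And>i p q. p \<in> {a..b} \<Longrightarrow> q \<in> {a..b} \<Longrightarrow> continuous_on {a..b} (\<lambda>e. g i e p q)"
    and anti: "\<And>i e p q p' q'. \<lbrakk>e \<in> {a..b}; p \<in> {a..b}; q \<in> {a..b}; p' \<in> {a..b}; q' \<in> {a..b};
        p \<le> p'; q \<le> q'\<rbrakk> \<Longrightarrow> g i e p' q' \<le> g i e p q"
    and left: "\<And>i p q. p \<in> {a..b} \<Longrightarrow> q \<in> {a..b} \<Longrightarrow> g i a p q < 0"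
    and right: "\<And>i p q. p \<in> {a..b} \<Longrightarrow> q \<in> {a..b} \<Longrightarrow> 0 \<le> g i b p q"
  shows "\<exists>M. (\<forall>i. M i \<in> {a..b} \<and> g i (M i) (M (i + 1)) (M (i - 1)) = 0) \<and>
    (\<forall>k. (\<forall>i. g (i + k) = g i) \<longrightarrow> (\<forall>i. M (i + k) = M i))"
proof -
  define S where "S = {m. \<forall>i. m i \<in> {a..b} \<and> 0 \<le> g i (m i) (m (i + 1)) (m (i - 1))}"
  define M where "M i = Inf ((\<lambda>m. m i) ` S)" for i
  have b_in: "(\<lambda>_. b) \<in> S" using ab right by (auto simp: S_def)
  have bdd: "bdd_below ((\<lambda>m. m i) ` S)" for i
    by (rule bdd_belowI[of _ a]) (auto simp: S_def)
  have M_le: "M i \<le> m i" if "m \<in> S" for m i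
    unfolding M_def using bdd that by (intro cINF_lower) auto
  have M_in: "M i \<in> {a..b}" for i
  proof -
    have "a \<le> M i" unfolding M_def by (rule cINF_greatest) (use b_in in \<open>auto simp: S_def\<close>)
    then show ?thesis using M_le[OF b_in] by simp
  qed
  have super: "0 \<le> g i (M i) (M (i + 1)) (M (i - 1))" for i
  proof -
    let ?C = "{e \<in> {a..b}. 0 \<le> g i e (M (i + 1)) (M (i - 1))}"
    have "closed ?C"
      using continuous_closed_preimage[OF cont[OF M_in M_in, of i "i + 1" "i - 1"], of "{0..}"]
      by (simp add: vimage_def Int_def)
    moreover have sub: "(\<lambda>m. m i) ` S \<subseteq> ?C"
    proof clarify
      fix m assume m: "m \<in> S"
      then have "0 \<le> g i (m i) (m (i + 1)) (m (i - 1))" by (auto simp: S_def)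
      also have "\<dots> \<le> g i (m i) (M (i + 1)) (M (i - 1))"
        using m M_in M_le[OF m] by (intro anti) (auto simp: S_def)
      finally show "m i \<in> {a..b} \<and> 0 \<le> g i (m i) (M (i + 1)) (M (i - 1))"
        using m by (auto simp: S_def)
    qed
    moreover have "M i \<in> closure ((\<lambda>m. m i) ` S)"
      unfolding M_def using b_in bdd by (intro closure_contains_Inf) auto
    ultimately show ?thesis using closure_minimal by blast
  qed
  have tight: "g i (M i) (M (i + 1)) (M (i - 1)) = 0" for i
  proof (rule ccontr)
    let ?h = "\<lambda>e. g i e (M (i + 1)) (M (i - 1))"
    assume "?h (M i) \<noteq> 0"
    then have pos: "0 < ?h (M i)" using super[of i] by simp
    then have "a < M i" using left[OF M_in M_in, of i "i + 1" "i - 1"] M_in[of i]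
      by (metis atLeastAtMost_iff less_asym order_le_less)
    have "continuous_on {a..M i} ?h"
      using M_in[of i] by (intro continuous_on_subset[OF cont[OF M_in M_in]]) auto
    with \<open>a < M i\<close> pos left[OF M_in M_in, of i "i + 1" "i - 1"]
    obtain e where e: "e \<in> {a..M i}" "?h e = 0"
      using IVT'[of ?h a 0 "M i"] by force
    then have "e < M i" using pos by (cases "e = M i") auto
    \<comment> \<open>Lowering the entry \<open>i\<close> to the zero \<open>e\<close> gives a supersolution below \<open>M\<close>.\<close>
    define M' where "M' = M(i := e)"
    have M'_le: "M' j \<le> M j" for j using e by (auto simp: M'_def)
    have M'_in: "M' j \<in> {a..b}" for j using e M_in[of i] M_in[of j] by (auto simp: M'_def)
    have "0 \<le> g j (M' j) (M' (j + 1)) (M' (j - 1))" for j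
    proof (cases "j = i")
      case True
      then show ?thesis using e by (simp add: M'_def)
    next
      case False
      have "0 \<le> g j (M j) (M (j + 1)) (M (j - 1))" by (rule super)
      also have "\<dots> \<le> g j (M j) (M' (j + 1)) (M' (j - 1))"
        by (intro anti M_in M'_in M'_le)
      finally show ?thesis using False by (simp add: M'_def)
    qed
    then have "M' \<in> S" using M'_in by (auto simp: S_def)
    then show False using M_le[of M' i] \<open>e < M i\<close> by (simp add: M'_def)
  qed
  have shift: "M (i + k) = M i" if per: "\<And>i. g (i + k) = g i" for k i
  proof -
    have per': "g (i - k) = g i" for i using per[of "i - k"] by simp
    have up: "(\<lambda>j. m (j + k)) \<in> S" if m: "m \<in> S" for m
      unfolding S_def
    proof (intro CollectI allI conjI)
      fix j
      have "m (j + k) \<in> {a..b} \<and> 0 \<le> g (j + k) (m (j + k)) (m (j + k + 1)) (m (j + k - 1))"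
        using m by (auto simp: S_def)
      then show "m (j + k) \<in> {a..b}" "0 \<le> g j (m (j + k)) (m (j + 1 + k)) (m (j - 1 + k))"
        by (auto simp: per algebra_simps)
    qed
    have down: "(\<lambda>j. m (j - k)) \<in> S" if m: "m \<in> S" for m
      unfolding S_def
    proof (intro CollectI allI conjI)
      fix j
      have "m (j - k) \<in> {a..b} \<and> 0 \<le> g (j - k) (m (j - k)) (m (j - k + 1)) (m (j - k - 1))"
        using m by (auto simp: S_def)
      then show "m (j - k) \<in> {a..b}" "0 \<le> g j (m (j - k)) (m (j + 1 - k)) (m (j - 1 - k))"
        by (auto simp: per' algebra_simps)
    qed
    have "(\<lambda>m. m (i + k)) ` S = (\<lambda>m. m i) ` S"
    proof (intro equalityI subsetI; elim imageE)
      fix x m assume "m \<in> S" "x = m (i + k)"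
      then show "x \<in> (\<lambda>m. m i) ` S"
        using imageI[OF up, of m "\<lambda>m. m i"] by simp
    next
      fix x m assume "m \<in> S" "x = m i"
      then show "x \<in> (\<lambda>m. m (i + k)) ` S"
        using imageI[OF down, of m "\<lambda>m. m (i + k)"] by simp
    qed
    then show ?thesis by (simp add: M_def)
  qed
  show ?thesis using M_in tight shift by blast
qed

text \<open>The graph of \<open>r\<close> is a closed subset of \<open>A \<times> [l, u]\<close>, and closed graphs over a compact range are
continuous.\<close>

lemma continuous_on_monotone_root:
  fixes f :: "real \<Rightarrow> real \<Rightarrow> real"
  assumes A: "closed A"
    and cont: "continuous_on (A \<times> {l..u}) (\<lambda>(e, t). f e t)"
    and inj: "\<And>e s t. \<lbrakk>e \<in> A; s \<in> {l..u}; t \<in> {l..u}; f e s = f e t\<rbrakk> \<Longrightarrow> s = t"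
    and r: "\<And>e. e \<in> A \<Longrightarrow> r e \<in> {l..u} \<and> f e (r e) = y"
  shows "continuous_on A r"
proof (rule continuous_from_closed_graph[OF compact_Icc[of l u]])
  show "r \<in> A \<rightarrow> {l..u}" using r by auto
  have "(\<lambda>x. (x, r x)) ` A = A \<times> {l..u} \<inter> (\<lambda>(e, t). f e t) -` {y}"
  proof (intro set_eqI iffI)
    fix p assume "p \<in> A \<times> {l..u} \<inter> (\<lambda>(e, t). f e t) -` {y}"
    then obtain e t where p: "p = (e, t)" "e \<in> A" "t \<in> {l..u}" "f e t = y" by auto
    then have "t = r e" using inj[of e t "r e"] r by auto
    then show "p \<in> (\<lambda>x. (x, r x)) ` A" using p by auto
  qed (use r in auto)
  then show "closed ((\<lambda>x. (x, r x)) ` A)"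
    using continuous_closed_preimage[OF cont, of "{y}"] A by (simp add: closed_Times)
qed

section \<open>Symbolic dynamics\<close>

text \<open>The symbol \<open>j\<close> stands for \<open>N + j\<close> full turns in the first phase. The compact set \<open>K j\<close> consists of the
points that start within time \<open>\<delta>\<close> of the inner turning point and after \<open>N + j\<close> turns end within time
\<open>\<delta>\<close> of it; a point in both sets would have a period of at most \<open>4 \<delta>\<close>. The bounds on \<open>\<tau>\<^sub>1\<close> express that
\<open>N\<close> turns on the slow level \<open>a\<close> take too long and \<open>N + 1\<close> turns on the fast level \<open>b\<close> are too short,
whatever the start and the end, and this is the sign condition at the two ends of \<open>[a, b]\<close> in
\<open>monotone_chain_solution\<close>.\<close>

lemma chaos_from_kick_window:
  assumes lam: "lam > 0" and mu: "mu < lam"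
    and ab: "0 < a" "a < b" "b < lam / 2" and \<delta>: "0 < \<delta>" "4 * \<delta> < period lam b"
    and \<tau>: "0 < \<tau>\<^sub>1" "0 < \<tau>\<^sub>2" and window: "kick_window lam mu a b \<delta> \<tau>\<^sub>2"
    and N: "(real N + 1) * period lam b + 2 * \<delta> < \<tau>\<^sub>1" "\<tau>\<^sub>1 < real N * period lam a - 2 * \<delta>"
  shows "induces_chaotic_dynamics (poincare_map (switched_forcing lam mu \<tau>\<^sub>1 \<tau>\<^sub>2) (\<tau>\<^sub>1 + \<tau>\<^sub>2)) 2"
proof -
  let ?h = "poincare_map (switched_forcing lam mu \<tau>\<^sub>1 \<tau>\<^sub>2) (\<tau>\<^sub>1 + \<tau>\<^sub>2)"
  let ?I = "{a..b}" and ?J = "{-\<delta>..\<delta>}" and ?P = "kicked_level lam mu \<tau>\<^sub>2"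
  have R: "2 * lam > 0" using lam by simp
  have e: "0 < e" "e < lam / 2" if "e \<in> ?I" for e using that ab by auto
  have range: "fst (newton_flow (2 * lam) mu s (orbit lam e t)) \<in> {- (2 * lam)..<0}"
    if "e \<in> ?I" "t \<in> ?J" "s \<in> {0..\<tau>\<^sub>2}" for e t s
    using window that unfolding kick_window_def[OF lam mu] by blast
  have P_decr: "?P e t < ?P e s" if "e \<in> ?I" "s \<in> ?J" "t \<in> ?J" "s < t" for e s t
    using window that unfolding kick_window_def[OF lam mu] by blast
  have P_ends: "level lam a \<le> ?P e (- \<delta>)" "?P e \<delta> \<le> level lam b" if "e \<in> ?I" for e
    using window that unfolding kick_window_def[OF lam mu] by blast+
  have connect: "newton_flow (2 * lam) mu \<tau>\<^sub>2 (orbit lam e t) = orbit lam e' (- t')"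
    if "e \<in> ?I" "e' \<in> ?I" "t \<in> ?J" "t' \<in> ?J" "?P e t = level lam e'" "?P e' t' = level lam e" for e e' t t'
    using window that unfolding kick_window_def[OF lam mu] by blast
  have level_le: "level lam e' \<le> level lam e" if "e \<in> ?I" "e' \<in> ?I" "e \<le> e'" for e e'
    using level_strict_antimono[of e e' lam] that ab by (cases "e = e'") auto
  have period_le: "period lam e' \<le> period lam e" if "e \<in> ?I" "e' \<in> ?I" "e \<le> e'" for e e'
    using period_strict_antimono[of e e' lam] that ab by (cases "e = e'") auto
  have P_cont: "continuous_on S (\<lambda>(e, t). ?P e t)" for S
    unfolding kicked_level_def[OF lam mu] energy_def case_prod_beta
    by (intro continuous_intros continuous_on_newton_flow[OF R] continuous_on_orbit[OF lam])
  have P_cont': "continuous_on S (?P e)" for S e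
    using continuous_on_compose2[OF P_cont[of UNIV], of S "\<lambda>t. (e, t)"]
    by (simp add: continuous_on_Pair)
  have "\<exists>t\<in>?J. ?P e t = level lam e'" if "e \<in> ?I" "e' \<in> ?I" for e e'
    using IVT2'[of "?P e" \<delta> "level lam e'" "- \<delta>"] P_ends[OF that(1)] P_cont'
      level_le[of a e'] level_le[of e' b] that ab \<delta> by fastforce
  then obtain r where r: "\<And>e e'. e \<in> ?I \<Longrightarrow> e' \<in> ?I \<Longrightarrow> r e e' \<in> ?J \<and> ?P e (r e e') = level lam e'"
    by metis
  have r_mono: "r e e' \<le> r e e''" if "e \<in> ?I" "e' \<in> ?I" "e'' \<in> ?I" "e' \<le> e''" for e e' e''
    using P_decr[of e "r e e''" "r e e'"] r[of e e'] r[of e e''] level_le[of e' e''] that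
    by fastforce
  have r_cont: "continuous_on ?I (\<lambda>e. r e e')" if "e' \<in> ?I" for e'
  proof (rule continuous_on_monotone_root[where f = ?P and y = "level lam e'"])
    show "s = t" if "e \<in> ?I" "s \<in> ?J" "t \<in> ?J" "?P e s = ?P e t" for e s t
      using P_decr[of e s t] P_decr[of e t s] that by (cases s t rule: linorder_cases) auto
  qed (use r that P_cont in auto)
  have period_cont: "continuous_on ?I (period lam)"
    by (rule continuous_on_subset[OF continuous_on_period]) (use ab in auto)
  define X where "X j = {p \<in> ?I \<times> ?J. snd p + \<tau>\<^sub>1 - real (N + j) * period lam (fst p) \<in> ?J}" for j :: nat
  define K where "K j = (\<lambda>p. to_planar (orbit lam (fst p) (snd p))) ` X j" for j
  have X_compact: "compact (X j)" for j
  proof -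
    have "continuous_on (?I \<times> ?J) (\<lambda>p. snd p + \<tau>\<^sub>1 - real (N + j) * period lam (fst p))"
      by (intro continuous_intros continuous_on_compose2[OF period_cont]) auto
    then have "closed (?I \<times> ?J \<inter> (\<lambda>p. snd p + \<tau>\<^sub>1 - real (N + j) * period lam (fst p)) -` ?J)"
      by (intro continuous_closed_preimage closed_Times) auto
    moreover have "?I \<times> ?J \<inter> (\<lambda>p. snd p + \<tau>\<^sub>1 - real (N + j) * period lam (fst p)) -` ?J = X j"
      by (auto simp: X_def)
    ultimately have "compact (?I \<times> ?J \<inter> X j)"
      by (intro compact_Int_closed compact_Times) auto
    then show ?thesis by (simp add: X_def Int_def conj_commute conj_left_commute)
  qed
  have fst_neg: "fst (orbit lam e t) < 0" if "e \<in> ?I" for e t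
    using orbit_range[OF e[OF that], of t] e[OF that] by auto
  have K_compact: "compact (K j)" for j
    unfolding K_def to_planar_def
  proof (rule compact_continuous_image[OF _ X_compact])
    have cont: "continuous_on (X j) (\<lambda>p. orbit lam (fst p) (snd p))"
      by (intro continuous_on_orbit[OF lam] continuous_intros)
    have "fst (orbit lam (fst p) (snd p)) \<noteq> 0" if "p \<in> X j" for p
      using fst_neg[of "fst p" "snd p"] that by (auto simp: X_def)
    then show "continuous_on (X j) (\<lambda>p. (fst (orbit lam (fst p) (snd p)),
        snd (orbit lam (fst p) (snd p)) / fst (orbit lam (fst p) (snd p))))"
      by (intro continuous_on_Pair continuous_on_divide continuous_on_fst continuous_on_snd cont) auto
  qed
  have step: "?h (to_planar (orbit lam e t)) =
      Some (to_planar (newton_flow (2 * lam) mu \<tau>\<^sub>2 (orbit lam e (t + \<tau>\<^sub>1 - real (N + j) * period lam e))))"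
    if "(e, t) \<in> X j" for e t j
  proof -
    have eX: "e \<in> ?I" "t \<in> ?J" "t + \<tau>\<^sub>1 - real (N + j) * period lam e \<in> ?J" using that by (auto simp: X_def)
    have eq: "orbit lam e (t + \<tau>\<^sub>1) = orbit lam e (t + \<tau>\<^sub>1 - real (N + j) * period lam e)"
      using orbit_periodic[OF e[OF eX(1)], of "t + \<tau>\<^sub>1 - real (N + j) * period lam e" "N + j"]
      by (simp del: of_nat_add)
    show ?thesis
      unfolding eq[symmetric]
      by (rule poincare_map_orbit[OF e[OF eX(1)] \<tau>]) (unfold eq, rule range[OF eX(1,3)])
  qed
  have K_disjoint: "disjoint_family_on K {..<2}"
  proof -
    have False if p: "p \<in> X 0" and q: "q \<in> X 1"
      and pq: "to_planar (orbit lam (fst p) (snd p)) = to_planar (orbit lam (fst q) (snd q))" for p q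
    proof -
      have I: "fst p \<in> ?I" "fst q \<in> ?I" using p q by (auto simp: X_def)
      have "orbit lam (fst p) (snd p) = orbit lam (fst q) (snd q)"
        using to_planar_inj[OF pq] fst_neg[OF I(1), of "snd p"] by simp
      then have "level lam (fst p) = level lam (fst q)"
        using orbit_energy[OF e[OF I(1)], of "snd p"] orbit_energy[OF e[OF I(2)], of "snd q"] by simp
      then have same: "fst p = fst q" using level_inj e I by blast
      have "period lam b \<le> period lam (fst p)" using period_le[OF I(1), of b] I(1) ab by auto
      moreover have "\<bar>snd p\<bar> \<le> \<delta>" "\<bar>snd q\<bar> \<le> \<delta>"
        "\<bar>snd p + \<tau>\<^sub>1 - real N * period lam (fst p)\<bar> \<le> \<delta>"
        "\<bar>snd q + \<tau>\<^sub>1 - (real N * period lam (fst p) + period lam (fst p))\<bar> \<le> \<delta>"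
        using p q same by (auto simp: X_def distrib_right)
      ultimately show False using \<delta> by linarith
    qed
    then have "K 0 \<inter> K 1 = {}" unfolding K_def by blast
    then show ?thesis
      by (auto simp: disjoint_family_on_def less_2_cases_iff)
  qed
  have itinerary: "\<exists>w. follows_itinerary ?h K s w \<and> (\<forall>k. periodic_seq k s \<longrightarrow> periodic_seq k w)"
    if s: "range s \<subseteq> {..<2}" for s
  proof -
    \<comment> \<open>Zeros of \<open>g i\<close>: the start \<open>- r x q\<close> and the end \<open>r x p\<close> of a stay on level \<open>x\<close> are \<open>\<tau>\<^sub>1\<close> apart, up to
      \<open>N + s i\<close> turns.\<close>
    define g where "g i x p q = \<tau>\<^sub>1 - r x p - r x q - real (N + s i) * period lam x" for i x p q
    have s_le: "s i \<le> 1" for i using s by (auto simp: image_subset_iff less_2_cases_iff le_Suc_eq)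
    have "\<exists>M. (\<forall>i. M i \<in> ?I \<and> g i (M i) (M (i + 1)) (M (i - 1)) = 0) \<and>
      (\<forall>k. (\<forall>i. g (i + k) = g i) \<longrightarrow> (\<forall>i. M (i + k) = M i))"
    proof (rule monotone_chain_solution)
      show "continuous_on ?I (\<lambda>x. g i x p q)" if "p \<in> ?I" "q \<in> ?I" for i p q
        unfolding g_def using that by (intro continuous_intros r_cont period_cont)
      show "g i x p' q' \<le> g i x p q" if "x \<in> ?I" "p \<in> ?I" "q \<in> ?I" "p' \<in> ?I" "q' \<in> ?I" "p \<le> p'" "q \<le> q'"
        for i x p q p' q'
        using r_mono[of x p p'] r_mono[of x q q'] that by (simp add: g_def)
      show "g i a p q < 0" if "p \<in> ?I" "q \<in> ?I" for i p q
      proof -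
        have "real N * period lam a \<le> real (N + s i) * period lam a"
          using period_pos[of a lam] ab by (intro mult_right_mono) auto
        moreover have "- \<delta> \<le> r a p" "- \<delta> \<le> r a q" using r[of a p] r[of a q] that ab by auto
        ultimately show ?thesis using N(2) unfolding g_def by linarith
      qed
      show "0 \<le> g i b p q" if "p \<in> ?I" "q \<in> ?I" for i p q
      proof -
        have "real (N + s i) * period lam b \<le> (real N + 1) * period lam b"
          using period_pos[of b lam] ab s_le[of i] by (intro mult_right_mono) auto
        moreover have "r b p \<le> \<delta>" "r b q \<le> \<delta>" using r[of b p] r[of b q] that ab by auto
        ultimately show ?thesis using N(1) unfolding g_def by linarith
      qed
    qed (use ab in simp)
    then obtain M where M: "\<And>i. M i \<in> ?I" "\<And>i. g i (M i) (M (i + 1)) (M (i - 1)) = 0"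
      and M_per: "\<And>k i. (\<forall>i. g (i + k) = g i) \<Longrightarrow> M (i + k) = M i" by blast
    define t where "t i = - r (M i) (M (i - 1))" for i
    define w where "w i = to_planar (orbit lam (M i) (t i))" for i
    have arrive: "t i + \<tau>\<^sub>1 - real (N + s i) * period lam (M i) = r (M i) (M (i + 1))" for i
      using M(2)[of i] by (simp add: g_def t_def)
    have rJ: "r (M i) (M j) \<in> ?J" for i j using r M by blast
    have inX: "(M i, t i) \<in> X (s i)" for i
      using M(1) rJ[of i "i - 1"] rJ[of i "i + 1"] arrive[of i] by (simp add: X_def t_def)
    have "?h (w i) = Some (w (i + 1))" for i
    proof -
      have "newton_flow (2 * lam) mu \<tau>\<^sub>2 (orbit lam (M i) (r (M i) (M (i + 1)))) = orbit lam (M (i + 1)) (t (i + 1))"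
        unfolding t_def using r M(1) by (intro connect) auto
      then show ?thesis using step[OF inX[of i]] by (simp only: w_def arrive)
    qed
    moreover have "w i \<in> K (s i)" for i
      unfolding w_def K_def using inX[of i] by (force intro: image_eqI[where x = "(M i, t i)"])
    ultimately have "follows_itinerary ?h K s w" by (simp add: follows_itinerary_def)
    moreover have "periodic_seq k w" if "periodic_seq k s" for k
    proof -
      have "g (i + int k) = g i" for i
        using that by (simp add: g_def fun_eq_iff periodic_seq_def)
      then have per: "M (i + int k) = M i" for i using M_per by blast
      have "M (i + int k - 1) = M (i - 1)" for i using per[of "i - 1"] by (simp add: algebra_simps)
      with per show ?thesis by (simp add: periodic_seq_def w_def t_def)
    qed
    ultimately show ?thesis by blast
  qed
  have K_ne: "K j \<noteq> {}" if j: "j < 2" for j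
  proof -
    obtain w where "follows_itinerary ?h K (\<lambda>_. j) w"
      using itinerary[of "\<lambda>_. j"] j by auto
    then have "w 0 \<in> K j" by (simp add: follows_itinerary_def)
    then show ?thesis by blast
  qed
  have D_dom: "K j \<subseteq> dom ?h" for j
    unfolding K_def using step by fastforce
  have w_range: "range w \<subseteq> K 0 \<union> K 1" if "follows_itinerary ?h K s w" "range s \<subseteq> {..<2}" for s w
  proof (intro image_subsetI)
    fix i
    have "w i \<in> K (s i)" "s i < 2" using that by (auto simp: follows_itinerary_def)
    then show "w i \<in> K 0 \<union> K 1" by (auto simp: less_2_cases_iff)
  qed
  have "induces_chaotic_dynamics_on ?h 2 (K 0 \<union> K 1)"
    unfolding induces_chaotic_dynamics_on_def
  proof (intro conjI exI[of _ K] allI impI)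
    show "K 0 \<union> K 1 \<noteq> {}" using K_ne[of 0] by simp
    show "K 0 \<union> K 1 \<subseteq> dom ?h" using D_dom by blast
    show "K i \<subseteq> K 0 \<union> K 1" if "i < 2" for i using that by (auto simp: less_2_cases_iff)
    fix s :: "int \<Rightarrow> nat" assume s: "range s \<subseteq> {..<2}"
    show "\<exists>w. range w \<subseteq> K 0 \<union> K 1 \<and> follows_itinerary ?h K s w"
      using itinerary[OF s] w_range s by blast
    fix k :: nat assume "periodic_seq k s"
    then show "\<exists>w. range w \<subseteq> K 0 \<union> K 1 \<and> periodic_seq k w \<and> follows_itinerary ?h K s w"
      using itinerary[OF s] w_range s by blast
  qed (use K_ne K_compact K_disjoint in auto)
  then show ?thesis unfolding induces_chaotic_dynamics_def by blast
qed

theorem theorem4p1: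
  fixes lam\<^sub>1 lam\<^sub>2 :: real
  assumes "lam\<^sub>1 > 0" and "lam\<^sub>1 > lam\<^sub>2"
  shows "\<exists>U :: (real \<times> real) set. open U \<and> U \<noteq> {} \<and> U \<subseteq> {0<..} \<times> {0<..} \<and>
    (\<forall>(\<tau>\<^sub>1, \<tau>\<^sub>2)\<in>U. \<exists>m\<ge>2.
      induces_chaotic_dynamics (poincare_map (switched_forcing lam\<^sub>1 lam\<^sub>2 \<tau>\<^sub>1 \<tau>\<^sub>2) (\<tau>\<^sub>1 + \<tau>\<^sub>2)) m)"
proof -
  obtain a b \<delta> \<tau>\<^sub>l \<tau>\<^sub>h where ab: "0 < a" "a < b" "b < lam\<^sub>1 / 2" and \<delta>: "0 < \<delta>" "4 * \<delta> < period lam\<^sub>1 b"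
    and \<tau>: "0 < \<tau>\<^sub>l" "\<tau>\<^sub>l < \<tau>\<^sub>h" and window: "\<And>\<tau>. \<tau> \<in> {\<tau>\<^sub>l<..<\<tau>\<^sub>h} \<Longrightarrow> kick_window lam\<^sub>1 lam\<^sub>2 a b \<delta> \<tau>"
    by (rule kick_window_exists[OF assms]) blast
  let ?S = "period lam\<^sub>1 a" and ?T = "period lam\<^sub>1 b"
  have T: "0 < ?T" "?T < ?S"
    using period_pos[of b lam\<^sub>1] period_strict_antimono[OF ab] ab by auto
  \<comment> \<open>\<open>N\<close> turns accumulate a time lag \<open>N (?S - ?T)\<close> between the two levels, which has to exceed one more turn
    and the uncertainty \<open>4 \<delta>\<close> of the ends.\<close>
  obtain N :: nat where N: "(?T + 4 * \<delta>) / (?S - ?T) < real N" using reals_Archimedean2 by blast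
  define U where "U = {(real N + 1) * ?T + 2 * \<delta><..<real N * ?S - 2 * \<delta>} \<times> {\<tau>\<^sub>l<..<\<tau>\<^sub>h}"
  have "?T + 4 * \<delta> < real N * (?S - ?T)" using N T by (simp add: pos_divide_less_eq)
  then have "(real N + 1) * ?T + 2 * \<delta> < real N * ?S - 2 * \<delta>"
    unfolding right_diff_distrib distrib_right by linarith
  then have "U \<noteq> {}" using \<tau>(2) by (simp add: U_def)
  moreover have "open U" unfolding U_def by (intro open_Times) auto
  moreover have pos: "0 < \<tau>\<^sub>1" "0 < \<tau>\<^sub>2" if "(\<tau>\<^sub>1, \<tau>\<^sub>2) \<in> U" for \<tau>\<^sub>1 \<tau>\<^sub>2
  proof -
    have "0 < (real N + 1) * ?T" using T by (intro mult_pos_pos) auto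
    then have "0 < (real N + 1) * ?T + 2 * \<delta>" using \<delta> by linarith
    then show "0 < \<tau>\<^sub>1" "0 < \<tau>\<^sub>2" using that \<tau> by (auto simp: U_def)
  qed
  moreover have "induces_chaotic_dynamics (poincare_map (switched_forcing lam\<^sub>1 lam\<^sub>2 \<tau>\<^sub>1 \<tau>\<^sub>2) (\<tau>\<^sub>1 + \<tau>\<^sub>2)) 2"
    if "(\<tau>\<^sub>1, \<tau>\<^sub>2) \<in> U" for \<tau>\<^sub>1 \<tau>\<^sub>2
    using that by (intro chaos_from_kick_window[OF assms ab \<delta> pos[OF that] window]) (auto simp: U_def)
  ultimately show ?thesis by (intro exI[of _ U]) auto
qed

end
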